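(* The rank-one Drinfeld $\mathcal A$-module $\Psi$ associated with the shtuka function $f$ is of $\eta^{1/q}$-type, and for each $a\in\mathcal A$, $$\Psi_a=-\sum_{k=0}^{\deg(a)}\operatorname{Res}_{P_\rho}\!\left(\frac{a\,\omega^{(k+1)}}{f^{(0)}f^{(1)}\cdots f^{(k)}}\right)\tau^k .$$
   Context: Let $\mathcal K=\mathbb F_q(t)$ and let $K=\mathbb F_q(\theta)$ be its copy via $\iota:t\mapsto\theta$. Let $\rho\in\mathbb F_q[t]$ be monic irreducible of degree $N\ge 2$, $\eta$ a root of $\rho$, $\eta^{(i)}=\eta^{q^i}$ for $i\in\mathbb Z$ (depending only on $i$ mod $N$), $\theta^{(i)}=\theta^{q^i}$. Let $\mathcal A=H^0(\mathbb P^1-P_\rho,\mathcal O_{\mathbb P^1})$ be the ring of elements of $\mathcal K$ regular away from the place $P_\rho$ of $\rho$; it is generated over $\mathbb F_q$ by $T_i=t^i/\rho(t)$, $0\le i\le N-1$. For $a\in\mathcal A$, $\deg(a)=-N\,v_{P_\rho}(a)$. Let $L$ be a field containing $K(\eta)$. For $g\in L(t)$, $g^{(k)}$ is obtained by raising the coefficients in $L$ to the $q^k$-th power ($t$ fixed). Put $f(t)=\frac1{t-\eta}-\frac1{\theta-\eta}$, so $f^{(k)}(t)=\frac1{t-\eta^{(k)}}-\frac1{\theta^{(k)}-\eta^{(k)}}$; $\mathbf s_0=1$, $\mathbf s_i=f^{(0)}\cdots f^{(i-1)}$. The $\mathbf s_i$ form an $L$-basis of $\mathcal A\otimes_{\mathbb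 F_q}L=L[\frac1{t-\eta^{(i)}}:0\le i\le N-1]$. The Drinfeld module $\Psi:\mathcal A\to L\{\tau\}$ ($\tau c=c^q\tau$) is defined by $\Psi_a=\sum_i c_i\tau^i$ where $a=\sum_i c_i\mathbf s_i$, $c_i\in L$. A Drinfeld $\mathcal A$-module $\phi$ of rank one is said to be of type $\eta^{(k)}$ if the quotient of the leading coefficient of $\phi_{T_1}$ by that of $\phi_{T_0}$ is $\eta^{(k)}$ (here $\eta^{1/q}=\eta^{(-1)}$). The differentials $\omega^{(j)}$ ($j\ge 1$) are $$\omega^{(j)}=-\frac{\theta^{(j-1)}-\eta^{(j-2)}}{\theta^{(j-1)}-\eta^{(j-1)}}\cdot\frac{dt}{(t-\eta^{(j-2)})(t-\eta^{(j-1)})},$$ and for a differential $\omega_*$ on $\mathbb P^1_L$, $\operatorname{Res}_{P_\rho}\omega_*:=\sum_{i=0}^{N-1}\operatorname{Res}_{t=\eta^{(i)}}\omega_*$. *)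

theory Defs
  imports "HOL-Library.Cardinality" "HOL-Computational_Algebra.Computational_Algebra"
begin

text \<open>
  The field \<open>k(t)\<close> is \<^typ>\<open>'k poly fract\<close>. Functions out of it are given on a fraction
  \<open>a / b\<close> and are independent of the representation; this is shown below for the
  three cases that are used: injective ring homomorphisms, valuations at finite places and the
  valuation at infinity.
\<close>

definition poly_fract :: "'k::field poly \<Rightarrow> 'k poly fract" where
  "poly_fract p = Fraction_Field.Fract p 1"

abbreviation const_fract :: "'k::field \<Rightarrow> 'k poly fract" where
  "const_fract c \<equiv> poly_fract [:c:]"

definition var_t :: "'k::field poly fract" where
  "var_t = poly_fract [:0, 1:]"

definition field_hom :: "('k::field \<Rightarrow> 'l::field) \<Rightarrow> bool" where
  "field_hom h \<longleftrightarrow> h 1 = 1 \<and> (\<forall>x y. h (x + y) = h x + h y) \<and> (\<forall>x y. h (x * y) = h x * h y)"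

definition fract_ext :: "('k::field poly \<Rightarrow> 'r::field) \<Rightarrow> 'k poly fract \<Rightarrow> 'r" where
  "fract_ext \<phi> x = (THE y. \<exists>a b. b \<noteq> 0 \<and> x = Fraction_Field.Fract a b \<and> y = \<phi> a / \<phi> b)"

lemma fract_ext_Fract:
  assumes mult: "\<And>p r. \<phi> (p * r) = \<phi> p * \<phi> r"
    and nz: "\<And>p. p \<noteq> 0 \<Longrightarrow> \<phi> p \<noteq> 0"
    and "b \<noteq> 0"
  shows "fract_ext \<phi> (Fraction_Field.Fract a b) = \<phi> a / \<phi> b"
  unfolding fract_ext_def
proof (rule the_equality)
  show "\<exists>a' b'. b' \<noteq> 0 \<and> Fraction_Field.Fract a b = Fraction_Field.Fract a' b' \<and> \<phi> a / \<phi> b = \<phi> a' / \<phi> b'"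
    using assms(3) by blast
next
  fix y
  assume "\<exists>a' b'. b' \<noteq> 0 \<and> Fraction_Field.Fract a b = Fraction_Field.Fract a' b' \<and> y = \<phi> a' / \<phi> b'"
  then obtain a' b' where *: "b' \<noteq> 0" "Fraction_Field.Fract a b = Fraction_Field.Fract a' b'"
    "y = \<phi> a' / \<phi> b'" by blast
  then have "a * b' = a' * b" using assms(3) by (simp add: eq_fract)
  then have "\<phi> a * \<phi> b' = \<phi> a' * \<phi> b" by (metis mult)
  then show "y = \<phi> a / \<phi> b" using * assms(3) nz[of b] nz[of b']
    by (simp add: frac_eq_eq)
qed

definition fract_map :: "('k::field \<Rightarrow> 'l::field) \<Rightarrow> 'k poly fract \<Rightarrow> 'l poly fract" where
  "fract_map h = fract_ext (\<lambda>p. poly_fract (map_poly h p))"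

text \<open>
  The exponent of an irreducible \<open>P\<close> in \<open>p \<noteq> 0\<close>. The library's multiplicity is not available for
  \<^typ>\<open>'k poly\<close> when \<open>'k\<close> is only of class \<^class>\<open>field\<close>.
\<close>

definition poly_exponent :: "'k::field poly \<Rightarrow> 'k poly \<Rightarrow> nat" where
  "poly_exponent P p = Max {n. P ^ n dvd p}"

lemma poly_exponent_eqI:
  fixes P p :: "'k::field poly"
  assumes "P ^ n dvd p" "\<not> P ^ Suc n dvd p"
  shows "poly_exponent P p = n"
proof -
  have "{m. P ^ m dvd p} = {..n}"
  proof (intro equalityI subsetI)
    fix m assume "m \<in> {m. P ^ m dvd p}"
    then show "m \<in> {..n}"
      using assms(2) power_le_dvd[of P m p "Suc n"] not_less_eq_eq[of m n] by auto
  next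
    fix m assume "m \<in> {..n}"
    then show "m \<in> {m. P ^ m dvd p}"
      using assms(1) power_le_dvd[of P n p m] by auto
  qed
  then show ?thesis by (auto simp: poly_exponent_def intro!: Max_eqI)
qed

lemma poly_exponent_decompose:
  fixes P p :: "'k::field poly"
  assumes "irreducible P" "p \<noteq> 0"
  obtains r where "p = P ^ poly_exponent P p * r" "\<not> P dvd r"
proof -
  have P: "degree P > 0" "P \<noteq> 0"
    using assms(1) is_unit_iff_degree[of P] by (auto simp: irreducible_def)
  define S where "S = {n. P ^ n dvd p}"
  have bound: "n \<le> degree p" if "n \<in> S" for n
  proof -
    have "n * 1 \<le> n * degree P" using P(1) by (intro mult_le_mono2) simp
    also have "\<dots> = degree (P ^ n)" using P by (simp add: degree_power_eq)
    also have "\<dots> \<le> degree p" using that assms(2) by (auto simp: S_def intro: dvd_imp_degree_le)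
    finally show ?thesis by simp
  qed
  then have fin: "finite S" by (intro finite_subset[of S "{..degree p}"]) auto
  have "0 \<in> S" by (simp add: S_def)
  then have "Max S \<in> S" using fin by (intro Max_in) auto
  then obtain r where r: "p = P ^ Max S * r" unfolding S_def by (auto elim: dvdE)
  have "\<not> P dvd r"
  proof
    assume "P dvd r"
    then have "P ^ Max S * P dvd P ^ Max S * r" by (rule mult_dvd_mono[OF dvd_refl])
    then have "P ^ Suc (Max S) dvd p" using r by (metis power_Suc2)
    then have "Suc (Max S) \<in> S" by (simp add: S_def)
    then have "Suc (Max S) \<le> Max S" using fin by (rule Max_ge[rotated])
    then show False by (rule notE[OF Suc_n_not_le_n])
  qed
  have "Max S = poly_exponent P p" by (simp only: poly_exponent_def S_def)
  then show thesis using that[of r] r \<open>\<not> P dvd r\<close> by metis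
qed

lemma poly_exponent_mult:
  fixes P a b :: "'k::field poly"
  assumes "irreducible P" "a \<noteq> 0" "b \<noteq> 0"
  shows "poly_exponent P (a * b) = poly_exponent P a + poly_exponent P b"
proof -
  have P: "prime_elem P" using assms(1) by (rule field_poly_irreducible_imp_prime)
  let ?m = "poly_exponent P a" and ?n = "poly_exponent P b"
  obtain r where r: "a = P ^ ?m * r" "\<not> P dvd r" using poly_exponent_decompose assms by metis
  obtain s where s: "b = P ^ ?n * s" "\<not> P dvd s" using poly_exponent_decompose assms by metis
  have "a * b = (P ^ ?m * r) * (P ^ ?n * s)"
    using arg_cong2[OF r(1) s(1), of "(*)"] .
  also have "\<dots> = P ^ (?m + ?n) * (r * s)" by (simp only: power_add ac_simps)
  finally have ab: "a * b = P ^ (?m + ?n) * (r * s)" .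
  show ?thesis
  proof (rule poly_exponent_eqI)
    show "P ^ (?m + ?n) dvd a * b" unfolding ab by (rule dvd_triv_left)
    have "\<not> P dvd r * s" using P r(2) s(2) by (simp add: prime_elem_dvd_mult_iff)
    moreover have "P ^ (?m + ?n) \<noteq> 0" using P by (simp add: prime_elem_def)
    ultimately show "\<not> P ^ Suc (?m + ?n) dvd a * b"
      unfolding ab power_Suc2 by (simp only: dvd_mult_cancel_left) simp
  qed
qed

definition val_at :: "'k::field poly \<Rightarrow> 'k poly fract \<Rightarrow> int" where
  "val_at P x = (if x = 0 then 0 else
     THE n. \<exists>a b. a \<noteq> 0 \<and> b \<noteq> 0 \<and> x = Fraction_Field.Fract a b \<and>
       n = int (poly_exponent P a) - int (poly_exponent P b))"

definition val_inf :: "'k::field poly fract \<Rightarrow> int" where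
  "val_inf x = (if x = 0 then 0 else
     THE n. \<exists>a b. a \<noteq> 0 \<and> b \<noteq> 0 \<and> x = Fraction_Field.Fract a b \<and>
       n = int (degree b) - int (degree a))"

lemma val_at_Fract:
  fixes P a b :: "'k::field poly"
  assumes "irreducible P" "a \<noteq> 0" "b \<noteq> 0"
  shows "val_at P (Fraction_Field.Fract a b) = int (poly_exponent P a) - int (poly_exponent P b)"
proof -
  have "(THE n. \<exists>a' b'. a' \<noteq> 0 \<and> b' \<noteq> 0 \<and> Fraction_Field.Fract a b = Fraction_Field.Fract a' b' \<and>
       n = int (poly_exponent P a') - int (poly_exponent P b'))
      = int (poly_exponent P a) - int (poly_exponent P b)"
  proof (rule the_equality)
    fix n
    assume "\<exists>a' b'. a' \<noteq> 0 \<and> b' \<noteq> 0 \<and> Fraction_Field.Fract a b = Fraction_Field.Fract a' b' \<and>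
       n = int (poly_exponent P a') - int (poly_exponent P b')"
    then obtain a' b' where *: "a' \<noteq> 0" "b' \<noteq> 0"
      "Fraction_Field.Fract a b = Fraction_Field.Fract a' b'"
      "n = int (poly_exponent P a') - int (poly_exponent P b')" by blast
    then have "poly_exponent P (a * b') = poly_exponent P (a' * b)"
      using assms by (simp add: eq_fract)
    then show "n = int (poly_exponent P a) - int (poly_exponent P b)"
      using * assms by (simp add: poly_exponent_mult)
  qed (use assms in blast)
  then show ?thesis using assms by (simp add: val_at_def eq_fract Zero_fract_def)
qed

lemma val_inf_Fract:
  fixes a b :: "'k::field poly"
  assumes "a \<noteq> 0" "b \<noteq> 0"
  shows "val_inf (Fraction_Field.Fract a b) = int (degree b) - int (degree a)"
proof -
  have "(THE n. \<exists>a' b'. a' \<noteq> 0 \<and> b' \<noteq> 0 \<and> Fraction_Field.Fract a b = Fraction_Field.Fract a' b' \<and>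
       n = int (degree b') - int (degree a')) = int (degree b) - int (degree a)"
  proof (rule the_equality)
    fix n
    assume "\<exists>a' b'. a' \<noteq> 0 \<and> b' \<noteq> 0 \<and> Fraction_Field.Fract a b = Fraction_Field.Fract a' b' \<and>
       n = int (degree b') - int (degree a')"
    then obtain a' b' where *: "a' \<noteq> 0" "b' \<noteq> 0"
      "Fraction_Field.Fract a b = Fraction_Field.Fract a' b'"
      "n = int (degree b') - int (degree a')" by blast
    then have "degree (a * b') = degree (a' * b)" using assms by (simp add: eq_fract)
    then show "n = int (degree b) - int (degree a)"
      using * assms by (simp add: degree_mult_eq)
  qed (use assms in blast)
  then show ?thesis using assms by (simp add: val_inf_def eq_fract Zero_fract_def)
qed

text \<open>
  The places of the projective line over \<open>k\<close> are the monic irreducible polynomials and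
  infinity. By the convention that the valuations are 0 at \<open>x = 0\<close>, the
  zero function is regular everywhere.
\<close>

definition ring_A :: "'k::field poly \<Rightarrow> 'k poly fract set" where
  "ring_A \<rho> = {x. (\<forall>P. irreducible P \<and> lead_coeff P = 1 \<and> P \<noteq> \<rho> \<longrightarrow> 0 \<le> val_at P x) \<and> 0 \<le> val_inf x}"

definition deg_A :: "'k::field poly \<Rightarrow> 'k poly fract \<Rightarrow> int" where
  "deg_A \<rho> a = - int (degree \<rho>) * val_at \<rho> a"

definition gen_T :: "'k::field poly \<Rightarrow> nat \<Rightarrow> 'k poly fract" where
  "gen_T \<rho> i = var_t ^ i / poly_fract \<rho>"

text \<open>
  An element \<open>\<Sum>\<^sub>i c\<^sub>i \<tau>\<^sup>i\<close> of \<open>L{\<tau>}\<close> is represented by the polynomial with coefficients \<open>c\<^sub>i\<close>. Only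
  the additive structure of \<^typ>\<open>'l poly\<close> is used; the product, determined by
  \<open>\<tau> c = c\<^sup>q \<tau>\<close>, is the following.
\<close>

definition skew_mult :: "nat \<Rightarrow> 'l::field poly \<Rightarrow> 'l poly \<Rightarrow> 'l poly" where
  "skew_mult q u v = (\<Sum>i\<le>degree u. \<Sum>j\<le>degree v. monom (coeff u i * coeff v j ^ (q ^ i)) (i + j))"

text \<open>
  The structure homomorphism from \<open>A\<close> to \<open>L\<close> is the restriction of \<open>\<iota>\<close>, so \<open>L\<close> has generic
  characteristic. Outside of \<open>A\<close> the values of \<open>\<phi>\<close> are irrelevant.
\<close>

definition drinfeld_module ::
  "('k::{field,finite} poly fract \<Rightarrow> 'l::field) \<Rightarrow> 'k poly \<Rightarrow> nat \<Rightarrow> ('k poly fract \<Rightarrow> 'l poly) \<Rightarrow> bool" where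
  "drinfeld_module \<iota> \<rho> r \<phi> \<longleftrightarrow> r > 0 \<and>
     (\<forall>c. \<phi> (const_fract c) = [:\<iota> (const_fract c):]) \<and>
     (\<forall>a\<in>ring_A \<rho>. \<forall>b\<in>ring_A \<rho>. \<phi> (a + b) = \<phi> a + \<phi> b \<and> \<phi> (a * b) = skew_mult CARD('k) (\<phi> a) (\<phi> b)) \<and>
     (\<forall>a\<in>ring_A \<rho>. coeff (\<phi> a) 0 = \<iota> a) \<and>
     (\<forall>a\<in>ring_A \<rho> - {0}. int (degree (\<phi> a)) = int r * deg_A \<rho> a)"

text \<open>
  \<open>\<eta>\<^sup>(\<^sup>i\<^sup>)\<close> for an integer \<open>i\<close>. As \<open>\<eta>\<close> has degree \<open>N\<close> over the field with \<open>q\<close> elements,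
  reducing \<open>i\<close> modulo \<open>N\<close> gives the \<open>q\<^sup>i\<close>-th power for negative \<open>i\<close> as well.
\<close>

definition eta_conj :: "nat \<Rightarrow> nat \<Rightarrow> 'l::field \<Rightarrow> int \<Rightarrow> 'l" where
  "eta_conj q N \<eta> i = \<eta> ^ (q ^ nat (i mod int N))"

definition rank_one_of_type ::
  "('k::{field,finite} poly fract \<Rightarrow> 'l::field) \<Rightarrow> 'k poly \<Rightarrow> 'l \<Rightarrow> ('k poly fract \<Rightarrow> 'l poly) \<Rightarrow> int \<Rightarrow> bool" where
  "rank_one_of_type \<iota> \<rho> \<eta> \<phi> k \<longleftrightarrow> drinfeld_module \<iota> \<rho> 1 \<phi> \<and>
     lead_coeff (\<phi> (gen_T \<rho> 1)) / lead_coeff (\<phi> (gen_T \<rho> 0)) = eta_conj CARD('k) (degree \<rho>) \<eta> k"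

definition twist :: "nat \<Rightarrow> nat \<Rightarrow> 'l::field poly fract \<Rightarrow> 'l poly fract" where
  "twist q k = fract_map (\<lambda>c. c ^ (q ^ k))"

definition shtuka_f :: "'l::field \<Rightarrow> 'l \<Rightarrow> 'l poly fract" where
  "shtuka_f \<theta> \<eta> = 1 / (var_t - const_fract \<eta>) - const_fract (1 / (\<theta> - \<eta>))"

definition shtuka_s :: "nat \<Rightarrow> 'l::field \<Rightarrow> 'l \<Rightarrow> nat \<Rightarrow> 'l poly fract" where
  "shtuka_s q \<theta> \<eta> i = (\<Prod>j<i. twist q j (shtuka_f \<theta> \<eta>))"

text \<open>
  The coefficients of \<open>a\<close> are embedded in \<open>L\<close> by the restriction of \<open>\<iota>\<close> to the constants; this
  keeps \<open>t\<close>, which \<open>\<iota>\<close> itself sends to \<open>\<theta>\<close>.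
\<close>

definition Psi :: "('k::{field,finite} poly fract \<Rightarrow> 'l::field) \<Rightarrow> 'l \<Rightarrow> 'k poly fract \<Rightarrow> 'l poly" where
  "Psi \<iota> \<eta> a = (THE c. fract_map (\<lambda>x. \<iota> (const_fract x)) a =
     (\<Sum>i\<le>degree c. const_fract (coeff c i) * shtuka_s CARD('k) (\<iota> var_t) \<eta> i))"

text \<open>A differential \<open>g dt\<close> on the projective line over \<open>L\<close> is represented by \<open>g\<close>.\<close>

definition omega :: "nat \<Rightarrow> nat \<Rightarrow> 'l::field \<Rightarrow> 'l \<Rightarrow> nat \<Rightarrow> 'l poly fract" where
  "omega q N \<theta> \<eta> j =
     - const_fract ((\<theta> ^ (q ^ (j - 1)) - eta_conj q N \<eta> (int j - 2)) /
                    (\<theta> ^ (q ^ (j - 1)) - eta_conj q N \<eta> (int j - 1))) *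
     (1 / ((var_t - const_fract (eta_conj q N \<eta> (int j - 2))) *
           (var_t - const_fract (eta_conj q N \<eta> (int j - 1)))))"

text \<open>\<open>p(\<alpha> + X)\<close> is the expansion of \<open>p\<close> in the local parameter \<open>X = t - \<alpha>\<close>.\<close>

definition laurent_at :: "'l::field \<Rightarrow> 'l poly fract \<Rightarrow> 'l fls" where
  "laurent_at \<alpha> = fract_ext (\<lambda>p. fps_to_fls (fps_of_poly (pcompose p [:\<alpha>, 1:])))"

definition Res_rho :: "nat \<Rightarrow> nat \<Rightarrow> 'l::field \<Rightarrow> 'l poly fract \<Rightarrow> 'l" where
  "Res_rho q N \<eta> g = (\<Sum>i<N. fls_residue (laurent_at (eta_conj q N \<eta> (int i)) g))"

end

theory Submission
  imports Defs
begin

text \<open>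
  The functions \<open>s\<^sub>0, \<dots>, s\<^sub>n\<close> span the functions with polar divisor at most
  \<open>\<eta>\<^sup>(\<^sup>0\<^sup>) + \<dots> + \<eta>\<^sup>(\<^sup>n\<^sup>-\<^sup>1\<^sup>)\<close>, as the pole at \<open>\<eta>\<^sup>(\<^sup>n\<^sup>-\<^sup>1\<^sup>)\<close> can be lowered by subtracting a multiple of
  \<open>s\<^sub>n\<close>. The functional \<open>g \<mapsto> - Res (g \<omega>\<^sup>(\<^sup>k\<^sup>+\<^sup>1\<^sup>) / s\<^sub>k\<^sub>+\<^sub>1)\<close> is dual to this family:
  \<open>s\<^sub>i \<omega>\<^sup>(\<^sup>k\<^sup>+\<^sup>1\<^sup>) / s\<^sub>k\<^sub>+\<^sub>1\<close> has no pole over \<open>\<rho>\<close> for \<open>i < k\<close>, a single simple pole there for \<open>i = k\<close>, and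
  for \<open>i > k\<close> it has poles only over \<open>\<rho>\<close>, so that its residues sum to zero. This gives both the uniqueness
  of the expansion and the formula for its coefficients. Multiplicativity of \<open>\<Psi>\<close> follows from
  \<open>s\<^sub>i\<^sub>+\<^sub>k = s\<^sub>i s\<^sub>k\<^sup>(\<^sup>i\<^sup>)\<close> since \<open>A\<close> is fixed by twisting; the constant coefficient is read off at \<open>t = \<theta>\<close>,
  where \<open>f\<close> vanishes, and the leading one at the last pole \<open>\<eta>\<^sup>(\<^sup>n\<^sup>-\<^sup>1\<^sup>)\<close>.
\<close>

section \<open>Field homomorphisms and fractions of polynomials\<close>

locale field_homomorphism =
  fixes h :: "'a::field \<Rightarrow> 'b::field"
  assumes field_hom: "field_hom h"
begin

lemma hom_one [simp]: "h 1 = 1"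
  and hom_add [simp]: "h (x + y) = h x + h y"
  and hom_mult [simp]: "h (x * y) = h x * h y"
  using field_hom by (auto simp: field_hom_def)

lemma hom_zero [simp]: "h 0 = 0"
proof -
  have "h 0 + h 0 = h 0 + 0" using hom_add[of 0 0] by (simp only: add_0_right)
  then show ?thesis by (simp only: add_left_cancel)
qed

lemma hom_eq_0_iff [simp]: "h x = 0 \<longleftrightarrow> x = 0"
  using hom_mult[of x "inverse x"] by (cases "x = 0") auto

lemma hom_uminus [simp]: "h (- x) = - h x"
  using hom_add[of x "- x"] by (simp add: eq_neg_iff_add_eq_0 add.commute)

lemma hom_diff [simp]: "h (x - y) = h x - h y"
  using hom_add[of x "- y"] by simp

lemma hom_eq_iff [simp]: "h x = h y \<longleftrightarrow> x = y"
  using hom_eq_0_iff[of "x - y"] by (simp del: hom_eq_0_iff)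

lemma hom_power [simp]: "h (x ^ n) = h x ^ n"
  by (induction n) auto

lemma hom_divide [simp]: "h (x / y) = h x / h y"
  using hom_mult[of "x / y" y] by (cases "y = 0") (auto simp: field_simps)

lemma hom_sum [simp]: "h (sum f S) = (\<Sum>x\<in>S. h (f x))"
  by (induction S rule: infinite_finite_induct) auto

lemma hom_of_nat [simp]: "h (of_nat n) = of_nat n"
  by (induction n) auto

lemma map_poly_add [simp]: "map_poly h (p + r) = map_poly h p + map_poly h r"
  by (rule poly_eqI) (simp add: coeff_map_poly)

lemma map_poly_diff [simp]: "map_poly h (p - r) = map_poly h p - map_poly h r"
  by (rule poly_eqI) (simp add: coeff_map_poly)

lemma map_poly_mult [simp]: "map_poly h (p * r) = map_poly h p * map_poly h r"
  by (rule poly_eqI) (simp add: coeff_map_poly coeff_mult)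

lemma map_poly_power [simp]: "map_poly h (p ^ n) = map_poly h p ^ n"
  by (induction n) auto

lemma degree_map_poly_hom [simp]: "degree (map_poly h p) = degree p"
  by (rule degree_map_poly) auto

lemma map_poly_hom_eq_0_iff [simp]: "map_poly h p = 0 \<longleftrightarrow> p = 0"
  by (rule map_poly_eq_0_iff) auto

lemma map_poly_monom_hom [simp]: "map_poly h (monom c n) = monom (h c) n"
  by (rule map_poly_monom) auto

lemma map_poly_pCons_hom [simp]: "map_poly h (pCons c p) = pCons (h c) (map_poly h p)"
  by (rule map_poly_pCons) auto

end

lemma poly_fract_0 [simp]: "poly_fract 0 = 0"
  and poly_fract_1 [simp]: "poly_fract 1 = 1"
  and poly_fract_add: "poly_fract (p + r) = poly_fract p + poly_fract r"
  and poly_fract_diff: "poly_fract (p - r) = poly_fract p - poly_fract r"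
  and poly_fract_mult: "poly_fract (p * r) = poly_fract p * poly_fract r"
  and poly_fract_eq_iff [simp]: "poly_fract p = poly_fract r \<longleftrightarrow> p = r"
  by (simp_all add: poly_fract_def Zero_fract_def One_fract_def eq_fract)

lemma poly_fract_eq_0_iff [simp]: "poly_fract p = 0 \<longleftrightarrow> p = 0"
  using poly_fract_eq_iff[of p 0] by (simp del: poly_fract_eq_iff)

lemma poly_fract_power: "poly_fract (p ^ n) = poly_fract p ^ n"
  by (induction n) (auto simp: poly_fract_mult)

lemma poly_fract_prod: "poly_fract (prod f S) = (\<Prod>x\<in>S. poly_fract (f x))"
  by (induction S rule: infinite_finite_induct) (auto simp: poly_fract_mult)

lemma Fract_conv_poly_fract: "Fraction_Field.Fract a b = poly_fract a / poly_fract b"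
  by (cases "b = 0") (simp_all add: poly_fract_def eq_fract Zero_fract_def)

lemma var_t_minus_const: "var_t - const_fract c = poly_fract [:- c, 1:]"
  by (simp add: var_t_def flip: poly_fract_diff)

lemma const_fract_hom: "field_homomorphism (\<lambda>c::'a::field. const_fract c)"
  by unfold_locales
    (simp add: field_hom_def pCons_one flip: poly_fract_add poly_fract_mult)

interpretation const_fract: field_homomorphism "\<lambda>c::'a::field. const_fract c"
  by (rule const_fract_hom)

lemma poly_fract_smult: "poly_fract (smult c p) = const_fract c * poly_fract p"
  by (simp flip: poly_fract_mult)

lemma poly_fract_conv_poly: "poly_fract p = poly (map_poly (\<lambda>c. const_fract c) p) var_t"
proof (induction p)
  case (pCons c p)
  have "pCons c p = [:c:] + [:0, 1:] * p" by simp
  then show ?case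
    using pCons by (simp add: var_t_def poly_fract_add poly_fract_mult del: mult_pCons_left mult_pCons_right)
qed simp

text \<open>An injective ring homomorphism into a field extends to the fraction field. Both the
  coefficientwise maps and the Laurent expansion at a point are extensions of this kind.\<close>

locale fract_extension =
  fixes \<phi> :: "'a::field poly \<Rightarrow> 'r::field"
  assumes \<phi>_add: "\<phi> (p + r) = \<phi> p + \<phi> r"
    and \<phi>_mult: "\<phi> (p * r) = \<phi> p * \<phi> r"
    and \<phi>_1: "\<phi> 1 = 1"
    and \<phi>_nz: "p \<noteq> 0 \<Longrightarrow> \<phi> p \<noteq> 0"
begin

lemma fract_ext_poly_fract [simp]: "fract_ext \<phi> (poly_fract p) = \<phi> p"
  unfolding poly_fract_def using fract_ext_Fract[of \<phi> 1 p, OF \<phi>_mult \<phi>_nz] by (simp add: \<phi>_1)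

lemma fract_ext_hom: "field_homomorphism (fract_ext \<phi>)"
proof
  have 1: "fract_ext \<phi> 1 = 1"
    using fract_ext_poly_fract[of 1] by (simp add: \<phi>_1)
  note F = fract_ext_Fract[of \<phi>, OF \<phi>_mult \<phi>_nz]
  have "fract_ext \<phi> (x + y) = fract_ext \<phi> x + fract_ext \<phi> y \<and>
        fract_ext \<phi> (x * y) = fract_ext \<phi> x * fract_ext \<phi> y" for x y
  proof -
    obtain a b where x: "x = Fraction_Field.Fract a b" "b \<noteq> 0" by (cases x) auto
    obtain c d where y: "y = Fraction_Field.Fract c d" "d \<noteq> 0" by (cases y) auto
    have "b * d \<noteq> 0" using x y by simp
    then show ?thesis
      using x y \<phi>_nz[of b] \<phi>_nz[of d] by (simp add: F \<phi>_add \<phi>_mult field_simps)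
  qed
  with 1 show "field_hom (fract_ext \<phi>)" by (simp add: field_hom_def)
qed

end

context field_homomorphism
begin

lemma fract_map_extension: "fract_extension (\<lambda>p. poly_fract (map_poly h p))"
  by unfold_locales (auto simp: poly_fract_add poly_fract_mult)

lemma fract_map_poly_fract [simp]: "fract_map h (poly_fract p) = poly_fract (map_poly h p)"
  unfolding fract_map_def by (rule fract_extension.fract_ext_poly_fract[OF fract_map_extension])

lemma fract_map_hom: "field_homomorphism (fract_map h)"
  unfolding fract_map_def by (rule fract_extension.fract_ext_hom[OF fract_map_extension])

end

lemma laurent_at_extension:
  "fract_extension (\<lambda>p::'a::field poly. fps_to_fls (fps_of_poly (pcompose p [:\<alpha>, 1:])))"
proof
  fix p :: "'a poly" assume "p \<noteq> 0"
  then have "pcompose p [:\<alpha>, 1:] \<noteq> 0" using pcompose_eq_0[of p "[:\<alpha>, 1:]"] by auto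
  then show "fps_to_fls (fps_of_poly (pcompose p [:\<alpha>, 1:])) \<noteq> 0"
    using fps_of_poly_eq_iff[of "pcompose p [:\<alpha>, 1:]" 0] by auto
qed (auto simp: pcompose_add pcompose_mult pcompose_1 fps_of_poly_add fps_of_poly_mult fls_times_fps_to_fls)

interpretation laurent_at: field_homomorphism "laurent_at \<alpha>" for \<alpha> :: "'a::field"
  unfolding laurent_at_def by (rule fract_extension.fract_ext_hom[OF laurent_at_extension])

lemma laurent_at_poly_fract:
  "laurent_at \<alpha> (poly_fract p) = fps_to_fls (fps_of_poly (pcompose p [:\<alpha>, 1:]))"
  unfolding laurent_at_def by (rule fract_extension.fract_ext_poly_fract[OF laurent_at_extension])

section \<open>Residues of rational functions\<close>

definition residue_at :: "'a::field \<Rightarrow> 'a poly fract \<Rightarrow> 'a" where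
  "residue_at \<alpha> g = fls_residue (laurent_at \<alpha> g)"

lemma residue_at_0 [simp]: "residue_at \<alpha> 0 = 0"
  and residue_at_add: "residue_at \<alpha> (g + g') = residue_at \<alpha> g + residue_at \<alpha> g'"
  and residue_at_uminus: "residue_at \<alpha> (- g) = - residue_at \<alpha> g"
  and residue_at_diff: "residue_at \<alpha> (g - g') = residue_at \<alpha> g - residue_at \<alpha> g'"
  by (auto simp: residue_at_def)

lemma residue_at_const_mult: "residue_at \<alpha> (const_fract c * g) = c * residue_at \<alpha> g"
  by (simp add: residue_at_def laurent_at_poly_fract fps_of_poly_const
      flip: fls_residue_def fls_const_def add: fls_residue_fls_const_times)

lemma residue_at_regular:
  assumes "poly v \<alpha> \<noteq> 0"
  shows "residue_at \<alpha> (poly_fract u / poly_fract v) = 0"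
proof -
  let ?F = "\<lambda>p. fps_of_poly (pcompose p [:\<alpha>, 1:])"
  have "?F v $ 0 \<noteq> 0" using assms by (simp add: coeff_pcompose_0)
  then have "subdegree (?F v) = 0" by simp
  then have "fps_to_fls (?F u) / fps_to_fls (?F v) = fps_to_fls (?F u * inverse (?F v))"
    by (simp only: divide_inverse fls_inverse_fps_to_fls fls_times_fps_to_fls)
  then show ?thesis by (simp add: residue_at_def laurent_at_poly_fract)
qed

lemma residue_at_pole_power:
  "residue_at \<alpha> (1 / poly_fract [:- \<alpha>, 1:] ^ n) = (if n = 1 then 1 else 0)"
proof -
  have "pcompose [:- \<alpha>, 1:] [:\<alpha>, 1:] = [:0, 1:]" by (simp add: pcompose_pCons)
  then have "laurent_at \<alpha> (poly_fract [:- \<alpha>, 1:]) = fls_X"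
    by (simp only: laurent_at_poly_fract fps_of_poly_fps_X fps_X_to_fls)
  then have "laurent_at \<alpha> (1 / poly_fract [:- \<alpha>, 1:] ^ n) = 1 / fls_X ^ n"
    by (simp only: laurent_at.hom_divide laurent_at.hom_power laurent_at.hom_one)
  also have "\<dots> = fls_X_inv ^ n"
    by (simp only: divide_inverse fls_inverse_X_power mult_1_left)
  finally show ?thesis by (simp add: residue_at_def)
qed

text \<open>Two distinct points \<alpha>, \<beta> of \<open>M\<close> allow the partial fraction
  1/((t-\<alpha>)(t-\<beta>)) = (1/(t-\<alpha>) - 1/(t-\<beta>))/(\<alpha>-\<beta>), after which two
  equal residue sums for one point fewer cancel. If all points coincide, only a simple pole has a
  residue.\<close>

lemma residue_sum_inverse_prod:
  fixes M :: "'a::field multiset"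
  assumes "finite E" "set_mset M \<subseteq> E" "M \<noteq> {#}"
  shows "(\<Sum>\<alpha>\<in>E. residue_at \<alpha> (1 / poly_fract (\<Prod>x\<in>#M. [:- x, 1:]))) = (if size M = 1 then 1 else 0)"
  using assms(2,3)
proof (induction "size M" arbitrary: M rule: less_induct)
  case less
  let ?D = "\<lambda>M::'a multiset. \<Prod>x\<in>#M. [:- x, 1:]"
  obtain \<alpha> where \<alpha>: "\<alpha> \<in># M" using less.prems by blast
  show ?case
  proof (cases "set_mset M \<subseteq> {\<alpha>}")
    case True
    then obtain n where n: "M = replicate_mset n \<alpha>" using set_mset_subset_singletonD by metis
    have D: "?D M = [:- \<alpha>, 1:] ^ n" by (simp add: n)
    have "residue_at \<beta> (1 / poly_fract (?D M)) = 0" if "\<beta> \<noteq> \<alpha>" for \<beta>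
      using residue_at_regular[of "?D M" \<beta> 1] that by (simp add: D)
    then have "(\<Sum>\<beta>\<in>E. residue_at \<beta> (1 / poly_fract (?D M))) = residue_at \<alpha> (1 / poly_fract (?D M))"
      using \<alpha> less.prems(1) assms(1) by (subst sum.mono_neutral_right[of E "{\<alpha>}"]) auto
    then show ?thesis
      by (simp add: D poly_fract_power residue_at_pole_power) (simp add: n)
  next
    case False
    then obtain \<beta> where \<beta>: "\<beta> \<in># M" "\<beta> \<noteq> \<alpha>" by blast
    obtain M1 where M1: "M = add_mset \<alpha> M1" using \<alpha> by (metis mset_add)
    then obtain M2 where M2: "M1 = add_mset \<beta> M2" using \<beta> by (metis insert_noteq_member mset_add)
    have nz: "\<alpha> - \<beta> \<noteq> 0" using \<beta> by simp
    have D_nz: "poly_fract (?D M2) \<noteq> 0"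
      by (auto simp: prod_mset_zero_iff)
    have "const_fract (\<alpha> - \<beta>) = poly_fract [:- \<beta>, 1:] - poly_fract [:- \<alpha>, 1:]"
      by (subst poly_fract_diff[symmetric], rule arg_cong[where f = poly_fract]) simp
    then have "const_fract (\<alpha> - \<beta>) * (1 / poly_fract (?D M)) =
        1 / poly_fract (?D (add_mset \<alpha> M2)) - 1 / poly_fract (?D (add_mset \<beta> M2))"
      using D_nz by (simp add: M1 M2 poly_fract_mult field_simps del: mult_pCons_left mult_pCons_right)
    then have "1 / poly_fract (?D M) = const_fract (1 / (\<alpha> - \<beta>)) *
        (1 / poly_fract (?D (add_mset \<alpha> M2)) - 1 / poly_fract (?D (add_mset \<beta> M2)))"
      using nz by (simp add: field_simps)
    moreover have "(\<Sum>x\<in>E. residue_at x (1 / poly_fract (?D (add_mset \<gamma> M2)))) = (if M2 = {#} then 1 else 0)"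
      if "\<gamma> \<in> {\<alpha>, \<beta>}" for \<gamma>
      using less.hyps[of "add_mset \<gamma> M2"] less.prems that by (auto simp: M1 M2)
    ultimately have "(\<Sum>x\<in>E. residue_at x (1 / poly_fract (?D M))) = 0"
      by (simp only: residue_at_const_mult residue_at_diff sum_subtractf flip: sum_distrib_left) simp
    then show ?thesis by (simp add: M1 M2)
  qed
qed

text \<open>The right-hand side is the residue at infinity up to sign.\<close>

lemma residue_sum:
  fixes M :: "'a::field multiset"
  assumes "finite E" "set_mset M \<subseteq> E" "degree p < size M"
  shows "(\<Sum>\<alpha>\<in>E. residue_at \<alpha> (poly_fract p / poly_fract (\<Prod>x\<in>#M. [:- x, 1:]))) = coeff p (size M - 1)"
  using assms(2,3)
proof (induction M arbitrary: p)
  case (add x M)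
  define p' where "p' = synthetic_div p x"
  define c where "c = poly p x"
  let ?D = "\<lambda>M::'a multiset. \<Prod>x\<in>#M. [:- x, 1:]"
  \<comment> \<open>Synthetic division trades one factor of the denominator for one degree of the
    numerator; the remainder falls under the case of numerator 1.\<close>
  have p: "p = [:- x, 1:] * p' + [:c:]"
    unfolding p'_def c_def by (rule synthetic_div_correct'[symmetric])
  have "poly_fract p = poly_fract [:- x, 1:] * poly_fract p' + const_fract c"
    by (subst p) (simp only: poly_fract_add poly_fract_mult)
  moreover have "poly_fract (?D M) \<noteq> 0" by (auto simp: prod_mset_zero_iff)
  ultimately have "poly_fract p / poly_fract (?D (add_mset x M)) =
      poly_fract p' / poly_fract (?D M) + const_fract c * (1 / poly_fract (?D (add_mset x M)))"
    by (simp add: poly_fract_mult field_simps del: mult_pCons_left mult_pCons_right)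
  then have eq: "(\<Sum>\<alpha>\<in>E. residue_at \<alpha> (poly_fract p / poly_fract (?D (add_mset x M)))) =
      (\<Sum>\<alpha>\<in>E. residue_at \<alpha> (poly_fract p' / poly_fract (?D M))) + c * (if M = {#} then 1 else 0)"
    using residue_sum_inverse_prod[OF assms(1) add.prems(1)]
    by (simp only: residue_at_const_mult residue_at_add sum.distrib flip: sum_distrib_left) simp
  show ?case
  proof (cases "M = {#}")
    case True
    then have "degree p = 0" using add.prems by simp
    then have "p' = 0" by (simp add: p'_def synthetic_div_eq_0_iff)
    then have "p = [:c:]" by (subst p) simp
    with \<open>p' = 0\<close> show ?thesis unfolding eq using True by simp
  next
    case False
    then obtain k where k: "size M = Suc k" by (cases "size M") auto
    have deg: "degree p' < size M"
      using add.prems False by (auto simp: p'_def degree_synthetic_div nonempty_has_size)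
    then have "coeff p' (Suc k) = 0" using k by (simp add: coeff_eq_0)
    then have "coeff p (Suc k) = coeff p' k" by (subst p) (simp add: coeff_pCons)
    then show ?thesis unfolding eq using add.IH[of p'] add.prems deg False k by simp
  qed
qed simp

section \<open>Finite fields\<close>

lemma finite_field_power_CARD:
  fixes x :: "'k::{field,finite}"
  shows "x ^ CARD('k) = x"
proof (cases "x = 0")
  case False
  let ?U = "UNIV - {0 :: 'k}"
  have "bij_betw ((*) x) ?U ?U"
    by (rule bij_betwI[of _ _ _ "\<lambda>y. y / x"]) (use False in auto)
  then have "(\<Prod>y\<in>?U. y) = (\<Prod>y\<in>?U. x * y)"
    by (rule prod.reindex_bij_betw[symmetric])
  also have "\<dots> = x ^ card ?U * (\<Prod>y\<in>?U. y)"
    by (simp add: prod.distrib)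
  finally have "x ^ card ?U = 1" by simp
  moreover have "CARD('k) = Suc (card ?U)"
    by (simp add: card_Suc_Diff1 del: card_Diff_insert)
  ultimately show ?thesis by (simp only: power_Suc mult_1_right)
qed (simp add: zero_less_card_finite)

lemma CARD_field_gt_1: "1 < CARD('k::{field,finite})"
proof -
  have "card {0, 1 :: 'k} \<le> CARD('k)" by (rule card_mono) auto
  then show ?thesis by simp
qed

text \<open>
  Over a field with \<open>q\<close> elements, \<open>(X + 1)^q\<close> and \<open>X^q + 1\<close> are monic of degree \<open>q\<close> and agree at
  all \<open>q\<close> points.
\<close>

lemma of_nat_choose_CARD_field:
  assumes "0 < i" "i < CARD('k)"
  shows "of_nat (CARD('k) choose i) = (0 :: 'k::{field,finite})"
proof -
  let ?q = "CARD('k)"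
  have "[:1, 1:] ^ ?q = monom 1 ?q + (1 :: 'k poly)"
  proof (rule poly_eqI_degree_lead_coeff[where A = UNIV and n = ?q])
    show "coeff ([:1, 1:] ^ ?q) ?q = coeff (monom 1 ?q + (1 :: 'k poly)) ?q"
      using assms by (simp add: coeff_linear_poly_power)
    show "degree ([:1, 1 :: 'k:] ^ ?q) \<le> ?q" by (simp add: degree_power_eq)
    show "degree (monom 1 ?q + (1 :: 'k poly)) \<le> ?q" by (intro degree_add_le) (auto simp: degree_monom_le)
  qed (auto simp: poly_monom finite_field_power_CARD add.commute)
  then have "coeff ([:1, 1 :: 'k:] ^ ?q) i = coeff (monom 1 ?q + 1) i" by (rule arg_cong)
  then show ?thesis using assms by (simp add: coeff_linear_poly_power)
qed

section \<open>Functions regular away from one place\<close>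

lemma poly_exponent_eq_0_iff:
  fixes P p :: "'k::field poly"
  assumes "irreducible P" "p \<noteq> 0"
  shows "poly_exponent P p = 0 \<longleftrightarrow> \<not> P dvd p"
proof -
  obtain r where r: "p = P ^ poly_exponent P p * r" "\<not> P dvd r"
    by (rule poly_exponent_decompose[OF assms])
  show ?thesis
  proof
    assume "poly_exponent P p = 0"
    then have "p = r" using r(1) by simp
    then show "\<not> P dvd p" using r by simp
  next
    assume "\<not> P dvd p"
    then show "poly_exponent P p = 0"
      by (subst (asm) r(1)) (cases "poly_exponent P p"; auto)
  qed
qed

lemma ex_monic_irreducible_factor:
  fixes p :: "'k::field poly"
  assumes "degree p > 0"
  obtains P where "irreducible P" "lead_coeff P = 1" "P dvd p"
proof -
  define g where "g = arg_min degree (\<lambda>g. g dvd p \<and> degree g > 0)"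
  have g: "g dvd p" "degree g > 0" and min: "\<And>h. h dvd p \<Longrightarrow> degree h > 0 \<Longrightarrow> degree g \<le> degree h"
    using arg_min_nat_lemma[of "\<lambda>g. g dvd p \<and> degree g > 0" p degree] assms
    unfolding g_def by auto
  have "g \<noteq> 0" using g by auto
  have irr: "irreducible g"
  proof (rule irreducibleI)
    fix a b assume ab: "g = a * b"
    have nz: "a \<noteq> 0" "b \<noteq> 0" using ab \<open>g \<noteq> 0\<close> by auto
    then have deg: "degree g = degree a + degree b" using ab by (simp add: degree_mult_eq)
    have "degree a = 0 \<or> degree g \<le> degree a"
      using min[of a] g(1) ab by (auto dest: dvd_mult_left)
    then show "a dvd 1 \<or> b dvd 1"
      using deg nz is_unit_iff_degree by auto
  qed (use g \<open>g \<noteq> 0\<close> is_unit_iff_degree[of g] in auto)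
  define P where "P = smult (inverse (lead_coeff g)) g"
  have l: "lead_coeff g \<noteq> 0" using g by auto
  have "irreducible P"
    using irr l irreducible_mult_unit_left[of "[:inverse (lead_coeff g):]" g]
    by (simp add: P_def is_unit_iff_degree)
  moreover have "lead_coeff P = 1" using l by (simp add: P_def)
  moreover have "P dvd p" using g(1) l by (simp add: P_def smult_dvd)
  ultimately show thesis by (rule that)
qed

text \<open>In a reduced fraction, regularity at the finite places other than \<rho> leaves only
  powers of \<rho> in the denominator, and regularity at infinity bounds the degree of the
  numerator. Reducedness makes \<open>m\<close> the exact pole order.\<close>

lemma ring_A_fraction:
  fixes \<rho> :: "'k::field poly"
  assumes \<rho>: "irreducible \<rho>" and a: "a \<in> ring_A \<rho>" "a \<noteq> 0"
  obtains m p where "a = poly_fract p / poly_fract \<rho> ^ m" "p \<noteq> 0" "degree p \<le> m * degree \<rho>"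
    "val_at \<rho> a = - int m" "m > 0 \<Longrightarrow> \<not> \<rho> dvd p"
proof -
  let ?Q = "\<lambda>v. v \<noteq> 0 \<and> (\<exists>u. a = Fraction_Field.Fract u v)"
  obtain v0 where "?Q v0" by (cases a) auto
  define v where "v = arg_min degree ?Q"
  have v: "?Q v" and min: "\<And>w. ?Q w \<Longrightarrow> degree v \<le> degree w"
    using arg_min_nat_lemma[of ?Q v0 degree] \<open>?Q v0\<close> unfolding v_def by auto
  obtain u where u: "a = Fraction_Field.Fract u v" using v by blast
  have u_nz: "u \<noteq> 0" using u a by (auto simp: Zero_fract_def eq_fract v)
  have coprime: "\<not> (P dvd u \<and> P dvd v)" if "irreducible P" for P
  proof
    assume "P dvd u \<and> P dvd v"
    then obtain u' v' where *: "u = P * u'" "v = P * v'" by (auto elim!: dvdE)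
    have nz: "P \<noteq> 0" "v' \<noteq> 0" using v * by auto
    then have "?Q v'" using u * by (auto simp: Fract_conv_poly_fract poly_fract_mult)
    then have "degree v \<le> degree v'" by (rule min)
    moreover have "degree P > 0" using that nz is_unit_iff_degree[of P] by (auto simp: irreducible_def)
    ultimately show False using * nz by (simp add: degree_mult_eq)
  qed
  have monic: "\<not> P dvd v" if "irreducible P" "lead_coeff P = 1" "P \<noteq> \<rho>" for P
  proof
    assume "P dvd v"
    then have "\<not> P dvd u" using coprime that by blast
    then have "poly_exponent P u = 0" using poly_exponent_eq_0_iff that u_nz by blast
    moreover have "poly_exponent P v > 0"
      using poly_exponent_eq_0_iff[of P v] \<open>P dvd v\<close> that v by blast
    moreover have "0 \<le> val_at P a" using a that by (auto simp: ring_A_def)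
    ultimately show False using val_at_Fract[OF that(1) u_nz, of v] u v by simp
  qed
  define m where "m = poly_exponent \<rho> v"
  obtain r where r: "v = \<rho> ^ m * r" "\<not> \<rho> dvd r"
    using poly_exponent_decompose[OF \<rho>, of v] v unfolding m_def by blast
  have r_nz: "r \<noteq> 0" using r v by auto
  have "degree r = 0"
  proof (rule ccontr)
    assume "degree r \<noteq> 0"
    then obtain P where P: "irreducible P" "lead_coeff P = 1" "P dvd r"
      using ex_monic_irreducible_factor[of r] by auto
    then have "P \<noteq> \<rho>" using r by auto
    moreover have "P dvd v" unfolding r(1) using P(3) by (rule dvd_mult)
    ultimately show False using monic P by blast
  qed
  then obtain c where c: "r = [:c:]" by (auto elim: degree_eq_zeroE)
  have c_nz: "c \<noteq> 0" using c r_nz by simp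
  define p where "p = smult (inverse c) u"
  have p_nz: "p \<noteq> 0" using u_nz c_nz by (simp add: p_def)
  have \<rho>_nz: "\<rho> \<noteq> 0" using \<rho> by auto
  have fr: "a = Fraction_Field.Fract p (\<rho> ^ m)"
    using u c_nz v \<rho>_nz by (simp add: eq_fract r c p_def)
  have nd: "\<not> \<rho> dvd p" if "m > 0"
  proof -
    have "\<rho> dvd v" using that r by auto
    then show ?thesis using coprime[OF \<rho>] c_nz by (auto simp: p_def dvd_smult_iff)
  qed
  have "0 \<le> val_inf a" using a by (simp add: ring_A_def)
  then have deg: "degree p \<le> m * degree \<rho>"
    using val_inf_Fract[of p "\<rho> ^ m"] p_nz \<rho>_nz fr
    by (simp add: degree_power_eq flip: of_nat_mult)
  \<comment> \<open>For \<open>m = 0\<close> the degree bound makes \<open>p\<close> a nonzero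
    constant, so \<rho> does not divide it in this case either.\<close>
  have "\<not> \<rho> dvd p"
  proof (cases "m = 0")
    case True
    then have "degree p = 0" using deg by simp
    then have "is_unit p" using p_nz is_unit_iff_degree by blast
    then show ?thesis using \<rho> dvd_trans[of \<rho> p 1] by (auto simp: irreducible_def)
  qed (use nd in auto)
  then have "poly_exponent \<rho> p = 0" using poly_exponent_eq_0_iff \<rho> p_nz by blast
  moreover have "poly_exponent \<rho> (\<rho> ^ m) = m"
  proof (rule poly_exponent_eqI)
    have "\<not> \<rho> dvd 1" using \<rho> by (auto simp: irreducible_def)
    then show "\<not> \<rho> ^ Suc m dvd \<rho> ^ m"
      using \<rho>_nz dvd_mult_cancel_left[of "\<rho> ^ m" \<rho> 1] by (simp del: power_Suc add: power_Suc2)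
  qed simp
  ultimately have "val_at \<rho> a = - int m"
    using val_at_Fract[OF \<rho> p_nz, of "\<rho> ^ m"] fr \<rho>_nz by simp
  with fr p_nz deg nd show thesis
    by (intro that[of p m]) (auto simp: Fract_conv_poly_fract poly_fract_power)
qed

section \<open>The Drinfeld module of the shtuka function\<close>

locale shtuka_setting =
  fixes \<iota> :: "'k::{field,finite} poly fract \<Rightarrow> 'l::field"
    and \<rho> :: "'k poly"
    and \<eta> :: 'l
    and q :: nat
  assumes \<iota>_hom: "field_hom \<iota>"
    and \<rho>_irreducible: "irreducible \<rho>"
    and \<rho>_monic: "lead_coeff \<rho> = 1"
    and \<rho>_degree: "degree \<rho> \<ge> 2"
    and \<eta>_root: "poly (map_poly (\<lambda>c. \<iota> (const_fract c)) \<rho>) \<eta> = 0"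
    and q_CARD: "q = CARD('k)"
begin

abbreviation N :: nat where "N \<equiv> degree \<rho>"

section \<open>Frobenius powers and the embedded constants\<close>

definition coef :: "'k \<Rightarrow> 'l" where "coef c = \<iota> (const_fract c)"
definition frob :: "nat \<Rightarrow> 'l \<Rightarrow> 'l" where "frob k x = x ^ (q ^ k)"
definition \<theta> :: 'l where "\<theta> = \<iota> var_t"
definition th :: "nat \<Rightarrow> 'l" where "th k = frob k \<theta>"
definition e :: "nat \<Rightarrow> 'l" where "e k = frob k \<eta>"

sublocale \<iota>: field_homomorphism \<iota>
  using \<iota>_hom by unfold_locales

sublocale coef: field_homomorphism coef
  by unfold_locales (simp add: field_hom_def coef_def)

lemma q_gt_1: "1 < q" unfolding q_CARD by (rule CARD_field_gt_1)

text \<open>The middle binomial coefficients vanish in \<open>'k\<close>, and \<open>coef\<close>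
  carries this to \<open>'l\<close>.\<close>

lemma power_q_add: "(x + y) ^ q = x ^ q + (y ^ q :: 'l)"
proof -
  have zero: "of_nat (q choose i) = (0 :: 'l)" if "0 < i" "i < q" for i
    using of_nat_choose_CARD_field[of i, where 'k = 'k] that coef.hom_of_nat[of "q choose i"]
    by (simp add: q_CARD)
  have "(x + y) ^ q = (\<Sum>i\<le>q. of_nat (q choose i) * x ^ i * y ^ (q - i))"
    by (rule binomial_ring)
  also have "\<dots> = (\<Sum>i\<in>{0, q}. of_nat (q choose i) * x ^ i * y ^ (q - i))"
    by (rule sum.mono_neutral_right) (use zero in auto)
  also have "\<dots> = x ^ q + y ^ q" using q_gt_1 by (simp add: add.commute)
  finally show ?thesis .
qed

lemma frob_0 [simp]: "frob 0 x = x"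
  by (simp add: frob_def)

lemma frob_frob: "frob i (frob k x) = frob (i + k) x"
  by (simp add: frob_def power_add mult.commute flip: power_mult)

sublocale frob: field_homomorphism "frob k" for k
proof
  have "frob k (x + y) = frob k x + frob k y" for x y
  proof (induction k)
    case (Suc k)
    have "frob (Suc k) z = frob k z ^ q" for z
      by (simp add: frob_def mult.commute flip: power_mult)
    then show ?case using Suc by (simp add: power_q_add)
  qed simp
  then show "field_hom (frob k)" by (simp add: field_hom_def frob_def power_mult_distrib)
qed

lemma frob_coef [simp]: "frob k (coef c) = coef c"
proof -
  have "c ^ (q ^ k) = c"
    by (induction k) (simp_all add: power_mult q_CARD finite_field_power_CARD)
  then show ?thesis by (simp add: frob_def flip: coef.hom_power)
qed

lemma poly_map_coef_frob: "poly (map_poly coef p) (frob k x) = frob k (poly (map_poly coef p) x)"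
  by (induction p) auto

lemma frob_th [simp]: "frob i (th k) = th (i + k)"
  and frob_e [simp]: "frob i (e k) = e (i + k)"
  by (simp_all add: th_def e_def frob_frob)

section \<open>Conjugates of \<eta> and the factorisation of \<rho>\<close>

lemma coef_root: "poly (map_poly coef \<rho>) \<eta> = 0"
  using \<eta>_root by (simp add: coef_def[abs_def])

text \<open>Frobenius commutes with evaluating a polynomial over \<open>'k\<close>, so
  \<open>p\<close> already vanishes at \<eta>. A nonzero polynomial of least degree vanishing at
  \<eta> divides both \<open>p\<close> and the irreducible \<rho>, hence is \<rho> up to a
  unit.\<close>

lemma \<rho>_dvd_of_root:
  assumes "poly (map_poly coef p) (e k) = 0"
  shows "\<rho> dvd p"
proof (cases "p = 0")
  case False
  have p: "poly (map_poly coef p) \<eta> = 0"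
    using assms by (simp add: e_def poly_map_coef_frob)
  let ?Q = "\<lambda>g. g \<noteq> 0 \<and> poly (map_poly coef g) \<eta> = 0"
  define g where "g = arg_min degree ?Q"
  have g: "?Q g" and min: "\<And>h. ?Q h \<Longrightarrow> degree g \<le> degree h"
    using arg_min_nat_lemma[of ?Q p degree] p False unfolding g_def by auto
  have dvd: "g dvd u" if "poly (map_poly coef u) \<eta> = 0" for u
  proof -
    have "u mod g = u - u div g * g" by (simp add: minus_div_mult_eq_mod)
    then have "poly (map_poly coef (u mod g)) \<eta> = 0"
      using that g by simp
    then have "u mod g = 0"
      using min[of "u mod g"] degree_mod_less[of g u] g by (meson leD)
    then show ?thesis by blast
  qed
  from dvd[OF coef_root] obtain r where r: "\<rho> = g * r" by (auto elim: dvdE)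
  have "\<not> g dvd 1"
  proof
    assume "g dvd 1"
    then obtain c where "g = [:c:]" by (auto simp: is_unit_poly_iff)
    then show False using g by simp
  qed
  then have "r dvd 1" using \<rho>_irreducible r by (auto dest: irreducibleD)
  then have "\<rho> dvd g" using r by (simp add: mult_unit_dvd_iff)
  then show ?thesis using dvd[OF p] by (rule dvd_trans)
qed simp

text \<open>If \<open>\<eta>\<close> is fixed by the \<open>d\<close>-th power of Frobenius, so are the \<open>q^N\<close> elements \<open>\<Sum>\<^sub>i c\<^sub>i \<eta>\<^sup>i\<close>.\<close>

lemma degree_le_of_frob_fixed:
  assumes "frob d \<eta> = \<eta>" "d > 0"
  shows "N \<le> d"
proof -
  define F where "F = PiE {..<N} (\<lambda>_. UNIV :: 'k set)"
  define g where "g f = (\<Sum>i<N. coef (f i) * \<eta> ^ i)" for f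
  \<comment> \<open>The powers of \<eta> below \<open>N\<close> are independent over
    \<open>'k\<close>: a relation would be a multiple of \<rho> of smaller degree.\<close>
  have inj: "inj_on g F"
  proof (rule inj_onI)
    fix f f' assume f: "f \<in> F" "f' \<in> F" and eq: "g f = g f'"
    define p where "p = (\<Sum>i<N. monom (f i - f' i) i)"
    have co: "coeff p i = (if i < N then f i - f' i else 0)" for i
      by (simp add: p_def coeff_sum sum.delta)
    have m: "map_poly coef p = (\<Sum>i<N. monom (coef (f i) - coef (f' i)) i)"
      by (rule poly_eqI) (simp add: coeff_map_poly co coeff_sum sum.delta)
    have "poly (map_poly coef p) \<eta> = g f - g f'"
      by (simp add: m g_def poly_sum poly_monom algebra_simps flip: sum_subtractf)
    then have "\<rho> dvd p" using \<rho>_dvd_of_root[of p 0] eq by (simp add: e_def)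
    moreover have "degree p < N" using \<rho>_degree by (intro degree_lessI) (auto simp: co)
    ultimately have "p = 0" using dvd_imp_degree_le[of \<rho> p] by force
    then have "f i = f' i" if "i < N" for i using co[of i] that by simp
    then show "f = f'" using f unfolding F_def by (intro PiE_ext) auto
  qed
  \<comment> \<open>Every \<open>g f\<close> is a root of this polynomial, which has at most
    \<open>q ^ d\<close> roots, while there are \<open>q ^ N\<close> values.\<close>
  define r where "r = monom 1 (q ^ d) - monom (1 :: 'l) 1"
  have qd: "1 < q ^ d" using q_gt_1 assms(2) by (rule one_less_power)
  then have deg_r: "degree r = q ^ d"
    unfolding r_def diff_conv_add_uminus by (subst degree_add_eq_left) (auto simp: degree_monom_eq)
  then have r_nz: "r \<noteq> 0" using qd q_gt_1 by auto
  have "g f \<in> {x. poly r x = 0}" for f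
  proof -
    have "frob d (g f) = g f" using assms(1) by (simp add: g_def)
    then show ?thesis by (simp add: r_def poly_monom frob_def)
  qed
  then have "card (g ` F) \<le> card {x. poly r x = 0}"
    by (intro card_mono poly_roots_finite r_nz) auto
  also have "\<dots> \<le> q ^ d" using card_poly_roots_bound[OF r_nz] deg_r by simp
  finally have "q ^ N \<le> q ^ d"
    using inj by (simp add: card_image F_def card_PiE q_CARD)
  then show ?thesis using q_gt_1 by (rule power_le_imp_le_exp[rotated])
qed

lemma e_root: "poly (map_poly coef \<rho>) (e k) = 0"
  by (simp add: e_def poly_map_coef_frob coef_root)

lemma e_eq_imp_degree_le:
  assumes "e i = e k" "i < k"
  shows "N \<le> k - i"
proof (rule degree_le_of_frob_fixed)
  have "frob i (frob (k - i) \<eta>) = frob i \<eta>"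
    using assms by (simp add: frob_frob e_def)
  then show "frob (k - i) \<eta> = \<eta>" by (simp only: frob.hom_eq_iff)
qed (use assms in simp)

lemma inj_on_e: "inj_on e {..<N}"
proof (rule linorder_inj_onI)
  fix i k assume "i < k" "i \<in> {..<N}" "k \<in> {..<N}"
  then show "e i \<noteq> e k" using e_eq_imp_degree_le[of i k] by force
qed auto

text \<open>Both sides are monic of degree \<open>N\<close> and vanish at the \<open>N\<close>
  distinct elements \<open>e 0\<close>, ..., \<open>e (N - 1)\<close>.\<close>

lemma map_coef_\<rho>: "map_poly coef \<rho> = (\<Prod>i<N. [:- e i, 1:])"
proof (rule poly_eqI_degree_lead_coeff[where A = "e ` {..<N}" and n = N])
  have deg: "degree (\<Prod>i<N. [:- e i, 1:]) = N" by (subst degree_prod_eq_sum_degree) auto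
  then show "degree (\<Prod>i<N. [:- e i, 1:]) \<le> N" by simp
  have "lead_coeff (\<Prod>i<N. [:- e i, 1:]) = 1" by (simp add: lead_coeff_prod)
  then show "coeff (map_poly coef \<rho>) N = coeff (\<Prod>i<N. [:- e i, 1:]) N"
    using deg \<rho>_monic by (simp add: coeff_map_poly)
  show "N \<le> card (e ` {..<N})" by (simp add: card_image inj_on_e)
qed (auto simp: e_root poly_prod intro!: prod_zero)

text \<open>\<open>e N\<close> is a root of \<rho>, hence equals some \<open>e i\<close> with
  \<open>i < N\<close>; the bound on repetitions leaves only \<open>i = 0\<close>, and Frobenius
  carries the equality to all indices.\<close>

lemma e_add_N [simp]: "e (k + N) = e k"
proof -
  have "poly (\<Prod>i<N. [:- e i, 1:]) (e N) = 0"
    using e_root[of N] by (simp add: map_coef_\<rho>)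
  then obtain i where i: "i < N" "e i = e N" by (auto simp: poly_prod)
  then have "N \<le> N - i" by (intro e_eq_imp_degree_le)
  then have "i = 0" using i by simp
  then have "e N = e 0" using i by simp
  then have "frob k (e N) = frob k (e 0)" by simp
  then show ?thesis by simp
qed

lemma e_add_mult_N [simp]: "e (m * N + k) = e k"
proof (induction m)
  case (Suc m)
  then show ?case using e_add_N[of "m * N + k"] by (simp add: algebra_simps)
qed simp

lemma e_mod_N [simp]: "e (k mod N) = e k"
  using e_add_mult_N[of "k div N" "k mod N"] by simp

lemma N_pos [simp]: "0 < N" using \<rho>_degree by simp

text \<open>The points above the place of \<rho>, kept as a set because poles may repeat while
  residues are summed once per point.\<close>

definition E :: "'l set" where "E = e ` {..<N}"

lemma finite_E [simp]: "finite E" by (simp add: E_def)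

lemma e_in_E [simp]: "e k \<in> E"
proof -
  have "e (k mod N) \<in> E" unfolding E_def by (intro imageI) simp
  then show ?thesis by simp
qed

lemma eta_conj_int [simp]: "eta_conj q N \<eta> (int k) = e k"
proof -
  have "eta_conj q N \<eta> (int k) = e (k mod N)"
    by (simp add: eta_conj_def e_def frob_def flip: zmod_int)
  then show ?thesis by simp
qed

lemma poly_map_coef_\<theta>: "poly (map_poly coef p) \<theta> = \<iota> (poly_fract p)"
  by (subst poly_fract_conv_poly, induction p) (simp_all add: \<theta>_def flip: coef_def)

text \<open>\<open>\<iota>\<close> is injective, so \<theta> is no root of \<rho> and neither are
  its Frobenius powers, whereas every \<open>e i\<close> is one.\<close>

lemma th_neq_e [simp]: "th k \<noteq> e i"
proof
  assume "th k = e i"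
  then have "frob k (poly (map_poly coef \<rho>) \<theta>) = 0"
    using e_root[of i] by (simp add: th_def flip: poly_map_coef_frob)
  then have "\<rho> = 0" by (simp add: poly_map_coef_\<theta>)
  then show False using \<rho>_degree by simp
qed

lemma th_notin_E: "\<alpha> \<in> E \<Longrightarrow> th k \<noteq> \<alpha>" by (auto simp: E_def)

section \<open>The twists of the shtuka function and their products\<close>

definition num :: "nat \<Rightarrow> 'l poly" where "num k = smult (1 / (th k - e k)) [:th k, - 1:]"
definition lin :: "nat \<Rightarrow> 'l poly" where "lin k = [:- e k, 1:]"
definition f :: "nat \<Rightarrow> 'l poly fract" where "f k = twist q k (shtuka_f \<theta> \<eta>)"
definition s :: "nat \<Rightarrow> 'l poly fract" where "s n = shtuka_s q \<theta> \<eta> n"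

lemma num_nz [simp]: "num k \<noteq> 0" and lin_nz [simp]: "lin k \<noteq> 0"
  by (simp_all add: num_def lin_def)

lemma degree_num_le: "degree (num k) \<le> 1" by (simp add: num_def)

lemma poly_num: "poly (num k) x = (th k - x) / (th k - e k)"
  by (simp add: num_def diff_divide_distrib)

lemma poly_num_nz: "\<alpha> \<in> E \<Longrightarrow> poly (num k) \<alpha> \<noteq> 0"
  by (simp add: poly_num th_notin_E)

lemma poly_num_e_nz [simp]: "poly (num k) (e i) \<noteq> 0"
  by (simp add: poly_num_nz)

lemma twist_conv_frob: "twist q k = fract_map (frob k)"
  by (simp add: twist_def frob_def[abs_def])

lemma twist_hom: "field_homomorphism (twist q k :: 'l poly fract \<Rightarrow> 'l poly fract)"
  unfolding twist_conv_frob by (rule frob.fract_map_hom)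

sublocale twist: field_homomorphism "twist q k :: 'l poly fract \<Rightarrow> 'l poly fract" for k
  by (rule twist_hom)

lemma twist_poly_fract: "twist q k (poly_fract p) = poly_fract (map_poly (frob k) p)"
  by (simp add: twist_conv_frob)

text \<open>Over a common denominator, \<open>f k\<close> shows a simple pole at \<open>e k\<close>
  and a simple zero at \<open>th k\<close>; \<open>num k\<close> is normalised to have value 1 at
  \<open>e k\<close>.\<close>

lemma f_frac: "f k = poly_fract (num k) / poly_fract (lin k)"
proof -
  have "e 0 = \<eta>" "th 0 = \<theta>" by (simp_all add: e_def th_def)
  then have "shtuka_f \<theta> \<eta> = 1 / poly_fract [:- e 0, 1:] - poly_fract [:1 / (th 0 - e 0):]"
    by (simp only: shtuka_f_def var_t_minus_const)
  then have "f k = 1 / poly_fract (lin k) - poly_fract [:1 / (th k - e k):]"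
    by (simp only: f_def lin_def twist.hom_diff twist.hom_divide twist_poly_fract twist.hom_one) simp
  also have "\<dots> = (poly_fract 1 - poly_fract [:1 / (th k - e k):] * poly_fract (lin k)) / poly_fract (lin k)"
    by (simp only: poly_fract_1) (simp add: field_simps)
  also have "poly_fract 1 - poly_fract [:1 / (th k - e k):] * poly_fract (lin k) = poly_fract (num k)"
    unfolding poly_fract_mult[symmetric] poly_fract_diff[symmetric] poly_fract_eq_iff
    by (simp add: num_def lin_def one_pCons field_simps)
  finally show ?thesis .
qed

lemma f_nz [simp]: "f k \<noteq> 0" by (simp add: f_frac)

lemma twist_f: "twist q i (f k) = f (i + k)"
proof -
  have "map_poly (frob i) (num k) = num (i + k)" by (simp add: num_def)
  moreover have "map_poly (frob i) (lin k) = lin (i + k)" by (simp add: lin_def)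
  ultimately show ?thesis by (simp add: f_frac twist_poly_fract)
qed

lemma s_prod: "s n = (\<Prod>i<n. f i)"
  by (simp add: s_def shtuka_s_def f_def)

lemma s_0 [simp]: "s 0 = 1" and s_Suc: "s (Suc n) = s n * f n"
  by (simp_all add: s_prod)

lemma s_nz [simp]: "s n \<noteq> 0" by (simp add: s_prod)

lemma s_split: "i \<le> m \<Longrightarrow> s m = s i * (\<Prod>l=i..<m. f l)"
  by (simp add: s_prod atLeast0LessThan[symmetric] prod.atLeastLessThan_concat)

lemma s_add: "s i * twist q i (s k) = s (i + k)"
  by (induction k) (simp_all add: s_Suc twist_f mult_ac)

section \<open>Expansions in the functions \<open>s n\<close>\<close>

definition D :: "nat \<Rightarrow> 'l poly" where "D n = (\<Prod>i<n. lin i)"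
definition S :: "nat \<Rightarrow> 'l poly" where "S n = (\<Prod>i<n. num i)"

lemma D_nz [simp]: "D n \<noteq> 0" by (simp add: D_def)

lemma s_frac: "s n = poly_fract (S n) / poly_fract (D n)"
  by (simp add: s_prod f_frac S_def D_def prod_dividef poly_fract_prod)

lemma degree_S_le: "degree (S n) \<le> n"
proof (induction n)
  case (Suc n)
  have "degree (S (Suc n)) \<le> degree (S n) + degree (num n)"
    unfolding S_def by (simp add: degree_mult_le)
  then show ?case using Suc degree_num_le[of n] by simp
qed (simp add: S_def)

lemma poly_S_e_nz [simp]: "poly (S n) (e i) \<noteq> 0"
  by (simp add: S_def poly_prod)

lemma poly_D_\<theta>_nz [simp]: "poly (D n) \<theta> \<noteq> 0"
  using th_neq_e[of 0] by (auto simp: D_def poly_prod lin_def th_def)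

lemma D_degree: "D N = map_poly coef \<rho>"
  by (simp add: D_def map_coef_\<rho> lin_def)

text \<open>The poles recur with period \<open>N\<close>, so each block of \<open>N\<close> factors
  multiplies to \<rho>. Thus powers of \<rho> are among the denominators covered by
  \<open>expansion\<close>.\<close>

lemma D_mult_degree: "D (m * N) = map_poly coef \<rho> ^ m"
proof (induction m)
  case (Suc m)
  have "D (m * N + k) = D (m * N) * D k" for k
    by (induction k) (simp_all add: D_def lin_def mult.assoc del: mult_pCons_left mult_pCons_right)
  then show ?case using Suc by (simp add: D_degree add.commute[of N])
qed (simp add: D_def)

text \<open>The linear map that \<open>Psi\<close> inverts: a skew polynomial is sent to the
  function having its coefficients as coordinates in the family \<open>s\<close>.\<close>

definition ev :: "'l poly \<Rightarrow> 'l poly fract" where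
  "ev c = (\<Sum>i\<le>degree c. const_fract (coeff c i) * s i)"

lemma ev_eq:
  assumes "degree c \<le> n"
  shows "ev c = (\<Sum>i\<le>n. const_fract (coeff c i) * s i)"
  unfolding ev_def by (rule sum.mono_neutral_left) (use assms in \<open>auto simp: coeff_eq_0\<close>)

lemma ev_add: "ev (c + c') = ev c + ev c'"
proof -
  define n where "n = max (degree c) (degree c')"
  have "degree c \<le> n" "degree c' \<le> n" "degree (c + c') \<le> n"
    by (auto simp: n_def degree_add_le_max)
  then show ?thesis
    by (simp add: ev_eq[where n = n] const_fract.hom_add distrib_right sum.distrib)
qed

lemma ev_0 [simp]: "ev 0 = 0" by (simp add: ev_def)

lemma ev_sum: "ev (sum c A) = (\<Sum>x\<in>A. ev (c x))"
  by (induction A rule: infinite_finite_induct) (simp_all add: ev_add)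

lemma ev_monom: "ev (monom x n) = const_fract x * s n"
proof -
  have "ev (monom x n) = (\<Sum>i\<le>n. const_fract (coeff (monom x n) i) * s i)"
    by (rule ev_eq) (rule degree_monom_le)
  also have "\<dots> = (\<Sum>i\<in>{n}. const_fract (coeff (monom x n) i) * s i)"
    by (rule sum.mono_neutral_right) auto
  finally show ?thesis by simp
qed

text \<open>
  The coefficient at \<open>s n\<close> is chosen so as to remove one pole at \<open>\<eta>\<^sup>(\<^sup>n\<^sup>-\<^sup>1\<^sup>)\<close>.
\<close>

lemma expansion:
  assumes "degree p \<le> n"
  shows "\<exists>c. degree c \<le> n \<and> poly_fract p / poly_fract (D n) = ev c \<and>
    coeff c 0 = poly p \<theta> / poly (D n) \<theta> \<and>
    (\<forall>m. n = Suc m \<longrightarrow> coeff c n = poly p (e m) / poly (S n) (e m))"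
  using assms
proof (induction n arbitrary: p)
  case 0
  then obtain a where "p = [:a:]" by (auto elim: degree_eq_zeroE)
  then show ?case by (intro exI[of _ "[:a:]"]) (simp add: D_def ev_def)
next
  case (Suc n)
  define a where "a = poly p (e n) / poly (S (Suc n)) (e n)"
  have "poly (p - smult a (S (Suc n))) (e n) = 0" by (simp add: a_def)
  then obtain p' where p': "p - smult a (S (Suc n)) = lin n * p'"
    unfolding poly_eq_0_iff_dvd lin_def by (auto elim: dvdE)
  have "degree (lin n * p') \<le> Suc n"
    unfolding p'[symmetric] using Suc.prems degree_S_le[of "Suc n"]
    by (intro degree_diff_le) (auto intro: order.trans[OF degree_smult_le])
  then have deg: "degree p' \<le> n"
    by (cases "p' = 0") (simp_all add: degree_mult_eq lin_def del: mult_pCons_left)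
  obtain c where c: "degree c \<le> n" "poly_fract p' / poly_fract (D n) = ev c"
    "coeff c 0 = poly p' \<theta> / poly (D n) \<theta>"
    using Suc.IH[OF deg] by blast
  have p: "p = lin n * p' + smult a (S (Suc n))" using p' by (simp add: algebra_simps)
  have D: "D (Suc n) = D n * lin n" by (simp add: D_def)
  have "poly_fract p / poly_fract (D (Suc n)) = ev c + const_fract a * s (Suc n)"
    unfolding c(2)[symmetric] s_frac
    by (subst p) (simp add: D poly_fract_add poly_fract_mult poly_fract_smult field_simps)
  then have 1: "poly_fract p / poly_fract (D (Suc n)) = ev (c + monom a (Suc n))"
    by (simp add: ev_add ev_monom)
  \<comment> \<open>\<open>num 0\<close> vanishes at \<theta>, so the added multiple of
    \<open>s (Suc n)\<close> leaves the value at \<theta>, and with it the constant coefficient,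
    unchanged.\<close>
  have "poly (S (Suc n)) \<theta> = 0"
    unfolding S_def poly_prod by (rule prod_zero) (auto intro!: bexI[of _ 0] simp: poly_num th_def)
  moreover have "poly (lin n) \<theta> \<noteq> 0"
    using th_neq_e[of 0 n] by (auto simp: lin_def th_def)
  ultimately have 2: "coeff (c + monom a (Suc n)) 0 = poly p \<theta> / poly (D (Suc n)) \<theta>"
    by (subst p) (simp add: c(3) D)
  have 3: "degree (c + monom a (Suc n)) \<le> Suc n"
    using c(1) by (intro degree_add_le) (auto intro: degree_monom_le)
  have 4: "coeff (c + monom a (Suc n)) (Suc n) = a"
    using c(1) by (simp add: coeff_eq_0)
  show ?case
    by (rule exI[of _ "c + monom a (Suc n)"]) (use 1 2 3 4 in \<open>simp add: a_def\<close>)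
qed

section \<open>The dual differentials and the residue functionals\<close>

definition prev :: "nat \<Rightarrow> 'l" where "prev k = eta_conj q N \<eta> (int k - 1)"

lemma prev_Suc [simp]: "prev (Suc k) = e k"
  by (simp add: prev_def)

text \<open>At \<open>k = 0\<close> the index is -1 modulo \<open>N\<close>, so
  \<open>prev 0\<close> is \<open>e (N - 1)\<close>; this wrap-around is why \<open>prev\<close> is
  defined by \<open>eta_conj\<close> instead of \<open>e\<close>.\<close>

lemma prev_in_E [simp]: "prev k \<in> E"
proof (cases k)
  case 0
  have "nat (- 1 mod int N) = N - 1"
    using \<rho>_degree by (simp add: zmod_minus1 nat_diff_distrib)
  then have "prev k = e (N - 1)" using 0 by (simp add: prev_def eta_conj_def e_def frob_def)
  then show ?thesis by simp
qed simp

definition w :: "nat \<Rightarrow> 'l poly fract" where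
  "w k = omega q N \<theta> \<eta> (Suc k) / f k"

lemma omega_conv:
  "omega q N \<theta> \<eta> (Suc k) = - const_fract ((th k - prev k) / (th k - e k)) *
     (1 / (poly_fract [:- prev k, 1:] * poly_fract (lin k)))"
proof -
  have "int (Suc k) - 2 = int k - 1" "int (Suc k) - 1 = int k" "Suc k - 1 = k" by auto
  then show ?thesis
    unfolding omega_def var_t_minus_const
    by (simp only: eta_conj_int prev_def[symmetric] lin_def th_def frob_def)
qed

text \<open>The pole of the differential at \<open>e k\<close> cancels against that of
  \<open>f k\<close>, and the zero of \<open>f k\<close> becomes a pole. What remains has simple
  poles only at \<open>prev k\<close> and \<open>th k\<close>, the latter outside
  \<open>E\<close>.\<close>

lemma w_conv:
  "w k = - const_fract (th k - prev k) / (poly_fract [:th k, - 1:] * poly_fract [:- prev k, 1:])"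
proof -
  have "const_fract ((th k - prev k) / (th k - e k)) =
      const_fract (th k - prev k) * const_fract (1 / (th k - e k))"
    by (simp flip: poly_fract_mult)
  moreover have "poly_fract (num k) = const_fract (1 / (th k - e k)) * poly_fract [:th k, - 1:]"
    unfolding num_def by (rule poly_fract_smult)
  moreover have "const_fract (1 / (th k - e k)) \<noteq> 0" by simp
  moreover have "poly_fract [:- prev k, 1:] \<noteq> 0" "poly_fract [:th k, - 1:] \<noteq> 0" "poly_fract (lin k) \<noteq> 0"
    by simp_all
  ultimately show ?thesis
    unfolding w_def omega_conv f_frac
    by (simp only: divide_simps mult_ac mult_minus_left mult_minus_right) simp
qed

definition R :: "nat \<Rightarrow> 'l poly fract \<Rightarrow> 'l" where
  "R k g = - (\<Sum>\<alpha>\<in>E. residue_at \<alpha> (g * omega q N \<theta> \<eta> (Suc k) / s (Suc k)))"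

lemma R_0 [simp]: "R k 0 = 0"
  by (simp add: R_def)

lemma R_add: "R k (g + g') = R k g + R k g'"
  by (simp add: R_def distrib_right add_divide_distrib residue_at_add sum.distrib)

lemma R_sum: "R k (sum g A) = (\<Sum>x\<in>A. R k (g x))"
  by (induction A rule: infinite_finite_induct) (simp_all add: R_add)

lemma R_const_mult: "R k (const_fract c * g) = c * R k g"
  unfolding R_def mult.assoc times_divide_eq_right[symmetric] residue_at_const_mult
  by (simp add: sum_distrib_left)

lemma R_s_conv: "R k (s i) = - (\<Sum>\<alpha>\<in>E. residue_at \<alpha> (s i / s k * w k))"
  by (simp add: R_def w_def s_Suc)

text \<open>\<open>s i / s k\<close> vanishes at \<open>prev k\<close>, since
  \<open>f (k - 1)\<close> has its pole there and is one of the inverted factors. This removes the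
  only pole of \<open>w k\<close> in \<open>E\<close>.\<close>

lemma R_s_less:
  assumes "i < k"
  shows "R k (s i) = 0"
proof -
  obtain m where m: "k = Suc m" "i \<le> m" using assms by (cases k) auto
  define A where "A = (\<Prod>l=i..<m. num l)"
  define B where "B = (\<Prod>l=i..<m. lin l)"
  have AB: "poly_fract A \<noteq> 0" "poly_fract B \<noteq> 0" by (auto simp: A_def B_def)
  have "s k = s i * (poly_fract A / poly_fract B) * (poly_fract (num m) / poly_fract (lin m))"
    unfolding m(1) s_Suc s_split[OF m(2)] f_frac A_def B_def prod_dividef poly_fract_prod ..
  moreover have "w k = - const_fract (th k - e m) / (poly_fract [:th k, - 1:] * poly_fract (lin m))"
    unfolding w_conv by (simp add: m(1) lin_def)
  moreover have "x / (x * (a / b) * (n / l)) * (- c / (t * l)) = - (c * (b / (a * n * t)))"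
    if "x \<noteq> 0" "b \<noteq> 0" "l \<noteq> 0" for x a b n l c t :: "'l poly fract"
    using that by (simp add: field_simps)
  ultimately have eq: "s i / s k * w k = - (const_fract (th k - e m) *
      (poly_fract B / poly_fract (A * num m * [:th k, - 1:])))"
    unfolding poly_fract_mult using AB s_nz[of i] lin_nz[of m] by (simp only: poly_fract_eq_0_iff not_False_eq_True)
  have nz: "poly (A * num m * [:th k, - 1:]) \<alpha> \<noteq> 0" if "\<alpha> \<in> E" for \<alpha>
    using that th_notin_E[of \<alpha> k] by (auto simp: A_def poly_prod poly_num_nz)
  have "residue_at \<alpha> (s i / s k * w k) = 0" if "\<alpha> \<in> E" for \<alpha>
    unfolding eq residue_at_uminus residue_at_const_mult residue_at_regular[OF nz[OF that]] by simp
  then show ?thesis by (simp add: R_s_conv)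
qed

text \<open>Here only \<open>w k\<close> is left. Its partial fractions are a simple pole at
  \<open>prev k\<close> with residue -1 and a term regular on \<open>E\<close>.\<close>

lemma R_s_same: "R k (s k) = 1"
proof -
  have partial_fractions: "- (x + y) / (x * y) = - (1 / y + 1 / x)" if "x \<noteq> 0" "y \<noteq> 0"
    for x y :: "'l poly fract"
    using that by (simp add: field_simps)
  have "const_fract (th k - prev k) = poly_fract [:th k, - 1:] + poly_fract [:- prev k, 1:]"
    unfolding poly_fract_add[symmetric] by (rule arg_cong[where f = poly_fract]) simp
  then have "w k = - (1 / poly_fract [:- prev k, 1:] + 1 / poly_fract [:th k, - 1:])"
    unfolding w_conv by (simp only:) (rule partial_fractions, simp_all)
  moreover have "(\<Sum>\<alpha>\<in>E. residue_at \<alpha> (1 / poly_fract [:- prev k, 1:])) = 1"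
    using residue_sum_inverse_prod[of E "{#prev k#}"] by simp
  moreover have "(\<Sum>\<alpha>\<in>E. residue_at \<alpha> (1 / poly_fract [:th k, - 1:])) = 0"
  proof (rule sum.neutral, rule ballI)
    fix \<alpha> assume "\<alpha> \<in> E"
    then have "poly [:th k, - 1:] \<alpha> \<noteq> 0" using th_notin_E[of \<alpha> k] by auto
    then show "residue_at \<alpha> (1 / poly_fract [:th k, - 1:]) = 0"
      using residue_at_regular[of "[:th k, - 1:]" \<alpha> 1] by simp
  qed
  ultimately show ?thesis
    by (simp add: R_s_conv residue_at_uminus residue_at_diff sum_subtractf sum_negf)
qed

text \<open>
  Here the zero of \<open>f k\<close> at \<open>\<theta>\<^sup>(\<^sup>k\<^sup>)\<close> cancels the pole of \<open>w k\<close>, so all poles lie over \<open>\<rho>\<close>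
  and the differential is regular at infinity.
\<close>

lemma R_s_greater:
  assumes "k < i"
  shows "R k (s i) = 0"
proof -
  define A where "A = (\<Prod>l=Suc k..<i. num l)"
  define B where "B = (\<Prod>l=Suc k..<i. lin l)"
  define c where "c = - ((th k - prev k) / (th k - e k))"
  have AB: "poly_fract B \<noteq> 0" by (auto simp: B_def)
  have "s i = s k * f k * (poly_fract A / poly_fract B)"
    unfolding s_Suc[symmetric] A_def B_def poly_fract_prod prod_dividef[symmetric] f_frac[symmetric]
    by (rule s_split) (use assms in simp)
  then have "s i / s k * w k = (poly_fract A / poly_fract B) * omega q N \<theta> \<eta> (Suc k)"
    by (simp add: w_def)
  also have "omega q N \<theta> \<eta> (Suc k) = const_fract c / (poly_fract [:- prev k, 1:] * poly_fract (lin k))"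
    unfolding omega_conv c_def by (simp add: const_fract.hom_uminus)
  also have "poly_fract A / poly_fract B * \<dots> =
      poly_fract (smult c A) / poly_fract ([:- prev k, 1:] * lin k * B)"
    unfolding poly_fract_mult poly_fract_smult by (simp add: mult_ac)
  also have "[:- prev k, 1:] * lin k * B =
      (\<Prod>x\<in>#add_mset (prev k) (add_mset (e k) (image_mset e (mset_set {Suc k..<i}))). [:- x, 1:])"
    by (simp add: B_def lin_def image_mset.compositionality comp_def mult.assoc
        prod_unfold_prod_mset del: mult_pCons_left mult_pCons_right)
  finally have eq: "s i / s k * w k = poly_fract (smult c A) / poly_fract
      (\<Prod>x\<in>#add_mset (prev k) (add_mset (e k) (image_mset e (mset_set {Suc k..<i}))). [:- x, 1:])" .
  \<comment> \<open>\<open>A\<close> has \<open>i - Suc k\<close> factors of degree at most one,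
    while the denominator has two points more. The coefficient read off thus lies one above the
    degree bound.\<close>
  have "degree A \<le> (\<Sum>l=Suc k..<i. 1)"
    unfolding A_def by (intro order.trans[OF degree_prod_sum_le] sum_mono) (auto simp: num_def)
  then have deg: "degree (smult c A) \<le> i - Suc k" by (auto intro: order.trans[OF degree_smult_le])
  then have "(\<Sum>\<alpha>\<in>E. residue_at \<alpha> (s i / s k * w k)) = coeff (smult c A) (Suc (i - Suc k))"
    unfolding eq by (subst residue_sum) (auto simp: le_imp_less_Suc)
  also have "\<dots> = 0" using deg by (intro coeff_eq_0) simp
  finally show ?thesis by (simp add: R_s_conv)
qed

lemma R_s: "R k (s i) = (if i = k then 1 else 0)"
  using R_s_less[of i k] R_s_same[of k] R_s_greater[of k i] by (cases i k rule: linorder_cases) auto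

lemma R_ev: "R k (ev c) = coeff c k"
proof -
  have "R k (ev c) = (\<Sum>i\<le>degree c. if i = k then coeff c i else 0)"
    unfolding ev_def R_sum R_const_mult R_s by (intro sum.cong) auto
  also have "\<dots> = coeff c k" by (simp add: sum.delta' coeff_eq_0)
  finally show ?thesis .
qed

section \<open>Expanding the elements of A\<close>

abbreviation \<phi> :: "'k poly fract \<Rightarrow> 'l poly fract" where "\<phi> \<equiv> fract_map coef"

sublocale \<phi>: field_homomorphism \<phi>
  by (rule coef.fract_map_hom)

text \<open>Uniqueness, by \<open>R_ev\<close>, turns any expansion found into the value of the
  definite description.\<close>

lemma Psi_eq:
  assumes "\<phi> a = ev c"
  shows "Psi \<iota> \<eta> a = c"
proof -
  have "Psi \<iota> \<eta> a = (THE c. \<phi> a = ev c)"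
    by (simp add: Psi_def ev_def s_def \<theta>_def coef_def[abs_def] flip: q_CARD)
  also have "\<dots> = c"
  proof (rule the_equality)
    show "\<phi> a = ev c" by (rule assms)
  next
    fix c' assume "\<phi> a = ev c'"
    then have "ev c' = ev c" using assms by simp
    then show "c' = c" by (metis R_ev poly_eqI)
  qed
  finally show ?thesis .
qed

text \<open>With a = p / \<rho>^m the denominator is \<open>D (m * N)\<close>, so
  \<open>expansion\<close> applies. The constant coefficient is the value at \<theta>, which is
  \<open>\<iota> a\<close>, and for m > 0 the top one is nonzero because \<rho> does not divide
  p.\<close>

lemma ring_A_expansion:
  assumes "a \<in> ring_A \<rho>"
  shows "\<phi> a = ev (Psi \<iota> \<eta> a) \<and> coeff (Psi \<iota> \<eta> a) 0 = \<iota> a \<and>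
    (a \<noteq> 0 \<longrightarrow> int (degree (Psi \<iota> \<eta> a)) = deg_A \<rho> a)"
proof (cases "a = 0")
  case True
  then have "Psi \<iota> \<eta> a = 0" by (intro Psi_eq) simp
  then show ?thesis using True by simp
next
  case False
  obtain m p where a: "a = poly_fract p / poly_fract \<rho> ^ m" and p: "p \<noteq> 0" "degree p \<le> m * N"
    and val: "val_at \<rho> a = - int m" and nd: "m > 0 \<Longrightarrow> \<not> \<rho> dvd p"
    using ring_A_fraction[OF \<rho>_irreducible assms False] by blast
  let ?p = "map_poly coef p"
  have \<phi>a: "\<phi> a = poly_fract ?p / poly_fract (D (m * N))"
    by (simp add: a D_mult_degree poly_fract_power)
  obtain c where c: "degree c \<le> m * N" "poly_fract ?p / poly_fract (D (m * N)) = ev c"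
    "coeff c 0 = poly ?p \<theta> / poly (D (m * N)) \<theta>"
    "\<And>l. m * N = Suc l \<Longrightarrow> coeff c (m * N) = poly ?p (e l) / poly (S (m * N)) (e l)"
    using expansion[of ?p "m * N"] p by auto
  have Psi: "Psi \<iota> \<eta> a = c" using \<phi>a c by (intro Psi_eq) simp
  have "coeff c 0 = \<iota> a"
    by (simp add: c(3) D_mult_degree poly_map_coef_\<theta> a)
  moreover have "degree c = m * N"
  proof (cases "m = 0")
    case False
    then obtain l where l: "m * N = Suc l" using \<rho>_degree by (cases "m * N") auto
    have "poly ?p (e l) \<noteq> 0" using \<rho>_dvd_of_root nd False by blast
    then have "coeff c (m * N) \<noteq> 0" using c(4)[OF l] by simp
    then show ?thesis using c(1) le_degree by (metis le_antisym)
  qed (use c(1) in simp)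
  ultimately show ?thesis
    using Psi \<phi>a c(2) by (simp add: deg_A_def val)
qed

lemma twist_\<phi> [simp]: "twist q i (\<phi> a) = \<phi> a"
proof (cases a)
  case (Fract u v)
  have "map_poly (frob i) (map_poly coef p) = map_poly coef p" for p
    by (rule poly_eqI) (simp add: coeff_map_poly)
  then show ?thesis using Fract by (simp add: Fract_conv_poly_fract twist_poly_fract)
qed

text \<open>\<open>\<phi> b\<close> has coefficients fixed by Frobenius, so in
  \<open>s i * \<phi> b\<close> it may be replaced by its \<open>i\<close>-th twist. This raises the
  coefficients of \<open>v\<close> to the power \<open>q ^ i\<close>, as \<open>skew_mult\<close>
  does, and turns \<open>s i\<close> and \<open>s k\<close> into \<open>s (i + k)\<close>.\<close>

lemma ev_skew_mult:
  assumes "\<phi> b = ev v"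
  shows "ev (skew_mult q u v) = ev u * \<phi> b"
proof -
  have tw: "s i * \<phi> b = (\<Sum>k\<le>degree v. const_fract (coeff v k ^ (q ^ i)) * s (i + k))" for i
  proof -
    have "s i * \<phi> b = s i * twist q i (ev v)" by (simp flip: assms)
    also have "\<dots> = (\<Sum>k\<le>degree v. const_fract (frob i (coeff v k)) * (s i * twist q i (s k)))"
      by (simp add: ev_def twist_poly_fract sum_distrib_left mult_ac)
    finally show ?thesis by (simp only: s_add frob_def)
  qed
  have "ev u * \<phi> b = (\<Sum>i\<le>degree u. const_fract (coeff u i) * (s i * \<phi> b))"
    by (simp add: ev_def sum_distrib_right mult.assoc)
  also have "\<dots> = (\<Sum>i\<le>degree u. \<Sum>k\<le>degree v.
      const_fract (coeff u i * coeff v k ^ (q ^ i)) * s (i + k))"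
    unfolding tw const_fract.hom_mult by (simp add: sum_distrib_left mult_ac)
  finally show ?thesis by (simp add: skew_mult_def ev_sum ev_monom)
qed

section \<open>The module axioms and the type\<close>

lemma drinfeld_module_Psi: "drinfeld_module \<iota> \<rho> 1 (Psi \<iota> \<eta>)"
  unfolding drinfeld_module_def
proof (intro conjI allI ballI)
  fix c
  show "Psi \<iota> \<eta> (const_fract c) = [:\<iota> (const_fract c):]"
    by (rule Psi_eq) (simp add: ev_def coef_def)
next
  fix a b assume ab: "a \<in> ring_A \<rho>" "b \<in> ring_A \<rho>"
  show "Psi \<iota> \<eta> (a + b) = Psi \<iota> \<eta> a + Psi \<iota> \<eta> b"
    using ab ring_A_expansion by (intro Psi_eq) (simp add: ev_add)
  show "Psi \<iota> \<eta> (a * b) = skew_mult CARD('k) (Psi \<iota> \<eta> a) (Psi \<iota> \<eta> b)"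
    using ab ring_A_expansion ev_skew_mult[of b "Psi \<iota> \<eta> b" "Psi \<iota> \<eta> a"]
    by (intro Psi_eq) (simp flip: q_CARD)
qed (use ring_A_expansion in auto)

text \<open>The top coefficient comes from the last pole \<open>e (N - 1)\<close>. The denominator
  does not depend on \<open>i\<close>, so it cancels in the quotient defining the type.\<close>

lemma lead_coeff_Psi_gen_T:
  assumes "i < 2"
  shows "lead_coeff (Psi \<iota> \<eta> (gen_T \<rho> i)) = e (N - 1) ^ i / poly (S N) (e (N - 1))"
proof -
  let ?p = "monom 1 i :: 'k poly"
  have deg: "degree (monom 1 i :: 'l poly) \<le> N"
    using assms \<rho>_degree by (simp add: degree_monom_eq)
  have "var_t ^ i = poly_fract ?p"
    by (simp add: var_t_def monom_altdef flip: poly_fract_power)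
  then have "\<phi> (gen_T \<rho> i) = poly_fract (monom 1 i) / poly_fract (D N)"
    by (simp add: gen_T_def D_degree)
  moreover obtain c where c: "degree c \<le> N" "poly_fract (monom 1 i) / poly_fract (D N) = ev c"
    "coeff c N = poly (monom 1 i) (e (N - 1)) / poly (S N) (e (N - 1))"
    using expansion[OF deg] \<rho>_degree by (cases N) auto
  ultimately have Psi: "Psi \<iota> \<eta> (gen_T \<rho> i) = c" by (intro Psi_eq) simp
  \<comment> \<open>This keeps the coefficient at \<open>N\<close> nonzero when
    \<open>i = 1\<close>: a zero conjugate would make \<rho> divide the variable, against
    \<open>N \<ge> 2\<close>.\<close>
  have "e (N - 1) \<noteq> 0"
  proof
    assume "e (N - 1) = 0"
    then have "\<rho> dvd [:0, 1:]" by (intro \<rho>_dvd_of_root[of _ "N - 1"]) simp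
    then have "N \<le> degree [:0, 1 :: 'k:]" by (rule dvd_imp_degree_le) simp
    then show False using \<rho>_degree by simp
  qed
  then have "coeff c N \<noteq> 0" by (simp add: c(3) poly_monom)
  then have "degree c = N" using c(1) le_degree by (metis le_antisym)
  then show ?thesis
    using c(3) by (simp add: Psi poly_monom)
qed

lemma rank_one_of_type_Psi: "rank_one_of_type \<iota> \<rho> \<eta> (Psi \<iota> \<eta>) (- 1)"
proof -
  have "eta_conj CARD('k) N \<eta> (- 1) = e (N - 1)"
    using \<rho>_degree by (simp add: eta_conj_def e_def frob_def zmod_minus1 nat_diff_distrib flip: q_CARD)
  then show ?thesis
    unfolding rank_one_of_type_def
    using drinfeld_module_Psi lead_coeff_Psi_gen_T[of 0] lead_coeff_Psi_gen_T[of 1] by simp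
qed

section \<open>The residue formula\<close>

lemma Res_rho_eq: "Res_rho q N \<eta> g = (\<Sum>\<alpha>\<in>E. residue_at \<alpha> g)"
  unfolding Res_rho_def E_def by (simp add: sum.reindex[OF inj_on_e] residue_at_def)

lemma Psi_residues:
  assumes "a \<in> ring_A \<rho>"
  shows "Psi \<iota> \<eta> a = - (\<Sum>k\<le>nat (deg_A \<rho> a). monom (Res_rho q N \<eta>
    (\<phi> a * omega q N \<theta> \<eta> (k + 1) / (\<Prod>j\<le>k. twist q j (shtuka_f \<theta> \<eta>)))) k)"
proof -
  have coeff: "coeff (Psi \<iota> \<eta> a) k = R k (\<phi> a)" for k
    using ring_A_expansion[OF assms] by (simp add: R_ev)
  have "degree (Psi \<iota> \<eta> a) \<le> nat (deg_A \<rho> a)"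
  \<comment> \<open>The degree formula speaks of nonzero elements only; for zero, \<open>Psi\<close>
    is the zero polynomial, which satisfies any bound.\<close>
  proof (cases "a = 0")
    case True
    then have "Psi \<iota> \<eta> a = 0" by (intro Psi_eq) simp
    then show ?thesis by simp
  next
    case False
    then have "deg_A \<rho> a = int (degree (Psi \<iota> \<eta> a))"
      using ring_A_expansion[OF assms] by simp
    then show ?thesis by simp
  qed
  then have "Psi \<iota> \<eta> a = (\<Sum>k\<le>nat (deg_A \<rho> a). monom (R k (\<phi> a)) k)"
    by (subst poly_as_sum_of_monoms'[symmetric]) (simp_all add: coeff)
  moreover have "R k (\<phi> a) = - Res_rho q N \<eta>
      (\<phi> a * omega q N \<theta> \<eta> (k + 1) / (\<Prod>j\<le>k. twist q j (shtuka_f \<theta> \<eta>)))" for k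
    by (simp add: R_def Res_rho_eq s_prod f_def lessThan_Suc_atMost)
  ultimately show ?thesis by (simp add: sum_negf flip: minus_monom)
qed

end

theorem theorem2:
  fixes \<iota> :: "'k::{field,finite} poly fract \<Rightarrow> 'l::field"
    and \<rho> :: "'k poly"
    and \<eta> :: 'l
  assumes "field_hom \<iota>"
    and "irreducible \<rho>" and "lead_coeff \<rho> = 1" and "degree \<rho> \<ge> 2"
    and "poly (map_poly (\<lambda>c. \<iota> (const_fract c)) \<rho>) \<eta> = 0"
  shows "rank_one_of_type \<iota> \<rho> \<eta> (Psi \<iota> \<eta>) (-1) \<and>
    (\<forall>a\<in>ring_A \<rho>. Psi \<iota> \<eta> a =
      - (\<Sum>k\<le>nat (deg_A \<rho> a).
           monom (Res_rho CARD('k) (degree \<rho>) \<eta>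
             (fract_map (\<lambda>x. \<iota> (const_fract x)) a
               * omega CARD('k) (degree \<rho>) (\<iota> var_t) \<eta> (k + 1)
               / (\<Prod>j\<le>k. twist CARD('k) j (shtuka_f (\<iota> var_t) \<eta>)))) k))"
proof -
  interpret shtuka_setting \<iota> \<rho> \<eta> "CARD('k)"
    using assms by unfold_locales auto
  show ?thesis
    using rank_one_of_type_Psi Psi_residues by (simp only: \<theta>_def coef_def[abs_def]) blast
qed

end
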